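(* Assume that for every $i\in I$ the right $A$-module $P_i=e_iP$ is finitely generated and projective. Then the colimit of the direct system $\underline{G}:\mathcal{Z}\to {}_A\mathcal{M}_A$, $\underline{G}(i)=P_i^*\otimes_{B_i}P_i$, is $\operatorname{colim}\underline{G}=(P^\dagger\otimes_B P,g)$, where the cocone $g$ consists of the maps $$g_i:\ P_i^*\otimes_{B_i}P_i\to P^\dagger\otimes_B P,\qquad g_i(\varphi_i\otimes_{B_i}p_i)=(\varphi_i\circ\tau_i)\otimes_B\sigma_i(p_i)\qquad(i\in I).$$
   Context: $k$ is a commutative ring and $A$ is a $k$-algebra with unit; ${}_A\mathcal{M}_A$ is the category of $A$-bimodules. A (not necessarily unital) $k$-algebra $B$ has idempotent local units if there is a set of idempotents $\{e_i\mid i\in I\}\subset B$ (indexed without repetition) such that for every finite $F\subset B$ there is $i\in I$ with $e_ib=be_i=b$ for all $b\in F$. Fix such a $B$. The index set $I$ is partially ordered by $i\le j$ iff $e_ie_j=e_je_i=e_i$; this order is directed. $\mathcal{Z}$ is the category with object set $I$ and exactly one morphism $a_{ji}:i\to j$ if $i\le j$, none otherwise; a direct system is a functor on $\mathcal{Z}$. Put $B_i=e_iBe_i$, a $k$-algebra with unit $e_i$; $B_i\subset B_j$ if $i\le j$. A left $B$-module $N$ is firm if the canonical map $B\otimes_BN\to N$ is an isomorphism (similarly on the right). $P$ is a firm $(B,A)$-bimodule, i.e. a $(B,A)$-bimodule firm as left $B$-module and unital as right $A$-module. Put $P_i=e_iP$, a $(B_i,A)$-bimodule. For $i\le j$, $\sigma_{ji}:P_i\to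 P_j$ is the inclusion and $\tau_{ij}:P_j\to P_i$, $\tau_{ij}(p)=e_ip$; $\sigma_i:P_i\to P$ is the inclusion and $\tau_i:P\to P_i$, $\tau_i(p)=e_ip$. Then $P$ with the $\sigma_i$ is the colimit of the $P_i$. $P^*=\operatorname{Hom}_A(P,A)$ and $P_i^*=\operatorname{Hom}_A(P_i,A)$ (right $A$-linear maps); $P_i^*$ is an $(A,B_i)$-bimodule via $(a\varphi b)(p)=a\varphi(bp)$. $P^\dagger=\{\varphi\in P^*\mid \exists i\in I:\ \varphi=\varphi\circ\sigma_i\circ\tau_i\}$, an $(A,B)$-bimodule via $(a\varphi b)(p)=a\varphi(bp)$. The direct system $\underline{G}$ is given by $\underline{G}(i)=P_i^*\otimes_{B_i}P_i$ and $\underline{G}(a_{ji})(\varphi_i\otimes_{B_i}p_i)=(\varphi_i\circ\tau_{ij})\otimes_{B_j}\sigma_{ji}(p_i)$. *)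

theory Defs
  imports "HOL-Algebra.Algebra"
begin

section \<open>Algebras, modules and bimodules over a commutative ring\<close>

text \<open>As for modules in the library, the multiplicative fields \<open>mult\<close> and \<open>one\<close> of the
  underlying ring record carry no meaning in records that represent modules and bimodules.
  Likewise the field \<open>one\<close> carries no meaning in a record for an algebra without unit.\<close>

record ('k, 's, 'm) rmod = "('k, 'm) module" +
  ract :: "'m \<Rightarrow> 's \<Rightarrow> 'm"  (infixl \<open>\<triangleleft>\<index>\<close> 70)

record ('k, 'r, 's, 'm) bimod = "('k, 's, 'm) rmod" +
  lact :: "'r \<Rightarrow> 'm \<Rightarrow> 'm"  (infixr \<open>\<triangleright>\<index>\<close> 70)

locale nonunital_algebra = module k B for k (structure) and B (structure) +
  assumes mult_closed: "\<lbrakk>x \<in> carrier B; y \<in> carrier B\<rbrakk> \<Longrightarrow> x \<otimes>\<^bsub>B\<^esub> y \<in> carrier B"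
    and mult_assoc: "\<lbrakk>x \<in> carrier B; y \<in> carrier B; z \<in> carrier B\<rbrakk> \<Longrightarrow>
      (x \<otimes>\<^bsub>B\<^esub> y) \<otimes>\<^bsub>B\<^esub> z = x \<otimes>\<^bsub>B\<^esub> (y \<otimes>\<^bsub>B\<^esub> z)"
    and mult_l_distr: "\<lbrakk>x \<in> carrier B; y \<in> carrier B; z \<in> carrier B\<rbrakk> \<Longrightarrow>
      (x \<oplus>\<^bsub>B\<^esub> y) \<otimes>\<^bsub>B\<^esub> z = x \<otimes>\<^bsub>B\<^esub> z \<oplus>\<^bsub>B\<^esub> y \<otimes>\<^bsub>B\<^esub> z"
    and mult_r_distr: "\<lbrakk>x \<in> carrier B; y \<in> carrier B; z \<in> carrier B\<rbrakk> \<Longrightarrow>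
      z \<otimes>\<^bsub>B\<^esub> (x \<oplus>\<^bsub>B\<^esub> y) = z \<otimes>\<^bsub>B\<^esub> x \<oplus>\<^bsub>B\<^esub> z \<otimes>\<^bsub>B\<^esub> y"
    and smult_mult_l: "\<lbrakk>c \<in> carrier k; x \<in> carrier B; y \<in> carrier B\<rbrakk> \<Longrightarrow>
      (c \<odot>\<^bsub>B\<^esub> x) \<otimes>\<^bsub>B\<^esub> y = c \<odot>\<^bsub>B\<^esub> (x \<otimes>\<^bsub>B\<^esub> y)"
    and smult_mult_r: "\<lbrakk>c \<in> carrier k; x \<in> carrier B; y \<in> carrier B\<rbrakk> \<Longrightarrow>
      x \<otimes>\<^bsub>B\<^esub> (c \<odot>\<^bsub>B\<^esub> y) = c \<odot>\<^bsub>B\<^esub> (x \<otimes>\<^bsub>B\<^esub> y)"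

locale unital_algebra = nonunital_algebra k A + ring A for k (structure) and A (structure)

locale right_module = S: nonunital_algebra k S + module k M
  for k :: "('k, 'w) ring_scheme" (structure)
    and S :: "('k, 's, 'x) module_scheme" (structure)
    and M :: "('k, 's, 'm, 'v) rmod_scheme" (structure) +
  assumes ract_closed: "\<lbrakk>m \<in> carrier M; s \<in> carrier S\<rbrakk> \<Longrightarrow> m \<triangleleft>\<^bsub>M\<^esub> s \<in> carrier M"
    and ract_add_l: "\<lbrakk>m \<in> carrier M; n \<in> carrier M; s \<in> carrier S\<rbrakk> \<Longrightarrow>
      (m \<oplus>\<^bsub>M\<^esub> n) \<triangleleft>\<^bsub>M\<^esub> s = m \<triangleleft>\<^bsub>M\<^esub> s \<oplus>\<^bsub>M\<^esub> n \<triangleleft>\<^bsub>M\<^esub> s"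
    and ract_add_r: "\<lbrakk>m \<in> carrier M; s \<in> carrier S; t \<in> carrier S\<rbrakk> \<Longrightarrow>
      m \<triangleleft>\<^bsub>M\<^esub> (s \<oplus>\<^bsub>S\<^esub> t) = m \<triangleleft>\<^bsub>M\<^esub> s \<oplus>\<^bsub>M\<^esub> m \<triangleleft>\<^bsub>M\<^esub> t"
    and ract_assoc: "\<lbrakk>m \<in> carrier M; s \<in> carrier S; t \<in> carrier S\<rbrakk> \<Longrightarrow>
      m \<triangleleft>\<^bsub>M\<^esub> (s \<otimes>\<^bsub>S\<^esub> t) = (m \<triangleleft>\<^bsub>M\<^esub> s) \<triangleleft>\<^bsub>M\<^esub> t"
    and smult_ract: "\<lbrakk>c \<in> carrier k; m \<in> carrier M; s \<in> carrier S\<rbrakk> \<Longrightarrow>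
      (c \<odot>\<^bsub>M\<^esub> m) \<triangleleft>\<^bsub>M\<^esub> s = c \<odot>\<^bsub>M\<^esub> (m \<triangleleft>\<^bsub>M\<^esub> s)"
    and ract_smult: "\<lbrakk>c \<in> carrier k; m \<in> carrier M; s \<in> carrier S\<rbrakk> \<Longrightarrow>
      m \<triangleleft>\<^bsub>M\<^esub> (c \<odot>\<^bsub>S\<^esub> s) = c \<odot>\<^bsub>M\<^esub> (m \<triangleleft>\<^bsub>M\<^esub> s)"

locale left_module = R: nonunital_algebra k R + module k M
  for k :: "('k, 'w) ring_scheme" (structure)
    and R :: "('k, 'r, 'x) module_scheme" (structure)
    and M :: "('k, 'r, 's, 'm, 'v) bimod_scheme" (structure) +
  assumes lact_closed: "\<lbrakk>r \<in> carrier R; m \<in> carrier M\<rbrakk> \<Longrightarrow> r \<triangleright>\<^bsub>M\<^esub> m \<in> carrier M"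
    and lact_add_r: "\<lbrakk>r \<in> carrier R; m \<in> carrier M; n \<in> carrier M\<rbrakk> \<Longrightarrow>
      r \<triangleright>\<^bsub>M\<^esub> (m \<oplus>\<^bsub>M\<^esub> n) = (r \<triangleright>\<^bsub>M\<^esub> m) \<oplus>\<^bsub>M\<^esub> (r \<triangleright>\<^bsub>M\<^esub> n)"
    and lact_add_l: "\<lbrakk>r \<in> carrier R; s \<in> carrier R; m \<in> carrier M\<rbrakk> \<Longrightarrow>
      (r \<oplus>\<^bsub>R\<^esub> s) \<triangleright>\<^bsub>M\<^esub> m = (r \<triangleright>\<^bsub>M\<^esub> m) \<oplus>\<^bsub>M\<^esub> (s \<triangleright>\<^bsub>M\<^esub> m)"
    and lact_assoc: "\<lbrakk>r \<in> carrier R; s \<in> carrier R; m \<in> carrier M\<rbrakk> \<Longrightarrow>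
      (r \<otimes>\<^bsub>R\<^esub> s) \<triangleright>\<^bsub>M\<^esub> m = r \<triangleright>\<^bsub>M\<^esub> (s \<triangleright>\<^bsub>M\<^esub> m)"
    and lact_smult: "\<lbrakk>c \<in> carrier k; r \<in> carrier R; m \<in> carrier M\<rbrakk> \<Longrightarrow>
      r \<triangleright>\<^bsub>M\<^esub> (c \<odot>\<^bsub>M\<^esub> m) = c \<odot>\<^bsub>M\<^esub> (r \<triangleright>\<^bsub>M\<^esub> m)"
    and smult_lact: "\<lbrakk>c \<in> carrier k; r \<in> carrier R; m \<in> carrier M\<rbrakk> \<Longrightarrow>
      (c \<odot>\<^bsub>R\<^esub> r) \<triangleright>\<^bsub>M\<^esub> m = c \<odot>\<^bsub>M\<^esub> (r \<triangleright>\<^bsub>M\<^esub> m)"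

locale bimodule = left_module k R M + right_module k S M
  for k :: "('k, 'w) ring_scheme" (structure)
    and R :: "('k, 'r, 'x) module_scheme" (structure)
    and S :: "('k, 's, 'y) module_scheme" (structure)
    and M :: "('k, 'r, 's, 'm, 'v) bimod_scheme" (structure) +
  assumes lact_ract: "\<lbrakk>r \<in> carrier R; m \<in> carrier M; s \<in> carrier S\<rbrakk> \<Longrightarrow>
      (r \<triangleright>\<^bsub>M\<^esub> m) \<triangleleft>\<^bsub>M\<^esub> s = r \<triangleright>\<^bsub>M\<^esub> (m \<triangleleft>\<^bsub>M\<^esub> s)"

definition left_unital :: "('r, 'u) ring_scheme \<Rightarrow> ('k, 'r, 's, 'm, 'v) bimod_scheme \<Rightarrow> bool"
  where "left_unital R M \<longleftrightarrow> (\<forall>m\<in>carrier M. \<one>\<^bsub>R\<^esub> \<triangleright>\<^bsub>M\<^esub> m = m)"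

definition right_unital :: "('s, 'u) ring_scheme \<Rightarrow> ('k, 's, 'm, 'v) rmod_scheme \<Rightarrow> bool"
  where "right_unital S M \<longleftrightarrow> (\<forall>m\<in>carrier M. m \<triangleleft>\<^bsub>M\<^esub> \<one>\<^bsub>S\<^esub> = m)"

text \<open>The objects and the morphisms of the category of \<open>A\<close>-bimodules. Morphisms are
  extensional functions, so that they are equal iff they agree on the carrier.\<close>

definition unital_bimodule ::
    "('k, 'w) ring_scheme \<Rightarrow> ('k, 'a) module \<Rightarrow> ('k, 'a, 'a, 'm) bimod \<Rightarrow> bool"
  where "unital_bimodule k A M \<longleftrightarrow> bimodule k A A M \<and> left_unital A M \<and> right_unital A M"

definition bimod_hom ::
    "('k, 'w) ring_scheme \<Rightarrow> ('k, 'r) module \<Rightarrow> ('k, 's) module \<Rightarrow>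
     ('k, 'r, 's, 'm) bimod \<Rightarrow> ('k, 'r, 's, 'n) bimod \<Rightarrow> ('m \<Rightarrow> 'n) set"
  where "bimod_hom k R S M N =
    {f \<in> carrier M \<rightarrow>\<^sub>E carrier N.
       (\<forall>x\<in>carrier M. \<forall>y\<in>carrier M. f (x \<oplus>\<^bsub>M\<^esub> y) = f x \<oplus>\<^bsub>N\<^esub> f y) \<and>
       (\<forall>c\<in>carrier k. \<forall>x\<in>carrier M. f (c \<odot>\<^bsub>M\<^esub> x) = c \<odot>\<^bsub>N\<^esub> f x) \<and>
       (\<forall>r\<in>carrier R. \<forall>x\<in>carrier M. f (r \<triangleright>\<^bsub>M\<^esub> x) = r \<triangleright>\<^bsub>N\<^esub> f x) \<and>
       (\<forall>s\<in>carrier S. \<forall>x\<in>carrier M. f (x \<triangleleft>\<^bsub>M\<^esub> s) = f x \<triangleleft>\<^bsub>N\<^esub> s)}"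


section \<open>Finitely generated projective right modules\<close>

definition right_hom ::
    "('s, 'u) ring_scheme \<Rightarrow> ('k, 's, 'm, 'v) rmod_scheme \<Rightarrow> ('k, 's, 'n, 'w) rmod_scheme \<Rightarrow>
     ('m \<Rightarrow> 'n) set"
  where "right_hom S M N =
    {f \<in> carrier M \<rightarrow>\<^sub>E carrier N.
       (\<forall>x\<in>carrier M. \<forall>y\<in>carrier M. f (x \<oplus>\<^bsub>M\<^esub> y) = f x \<oplus>\<^bsub>N\<^esub> f y) \<and>
       (\<forall>x\<in>carrier M. \<forall>s\<in>carrier S. f (x \<triangleleft>\<^bsub>M\<^esub> s) = f x \<triangleleft>\<^bsub>N\<^esub> s)}"

definition finitely_generated ::
    "('s, 'u) ring_scheme \<Rightarrow> ('k, 's, 'm, 'v) rmod_scheme \<Rightarrow> bool"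
  where "finitely_generated S M \<longleftrightarrow>
    (\<exists>F. finite F \<and> F \<subseteq> carrier M \<and>
       (\<forall>m\<in>carrier M. \<exists>c\<in>F \<rightarrow> carrier S. m = (\<Oplus>\<^bsub>M\<^esub>x\<in>F. x \<triangleleft>\<^bsub>M\<^esub> c x)))"

text \<open>Projectivity is the lifting property along surjections \<open>g : N \<rightarrow> N'\<close> of unital right modules.
  HOL cannot quantify over all carrier types here, so \<open>N\<close> and \<open>N'\<close> have their carriers in
  the types \<^typ>\<open>'m \<Rightarrow> 's\<close> and \<^typ>\<open>'m\<close>. This is no restriction: the free
  module of finitely supported functions \<open>M \<rightarrow> S\<close> and \<open>M\<close> itself live in these types, and lifting
  the identity of \<open>M\<close> along the canonical surjection from the former to the latter
  makes \<open>M\<close> a direct summand of a free module.\<close>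

definition projective ::
    "'k ring \<Rightarrow> ('k, 's) module \<Rightarrow> ('k, 's, 'm, 'v) rmod_scheme \<Rightarrow> bool"
  where "projective k S M \<longleftrightarrow>
    (\<forall>(N :: ('k, 's, 'm \<Rightarrow> 's) rmod) (N' :: ('k, 's, 'm) rmod).
       right_module k S N \<and> right_unital S N \<and> right_module k S N' \<and> right_unital S N' \<longrightarrow>
       (\<forall>g\<in>right_hom S N N'. \<forall>f\<in>right_hom S M N'. g ` carrier N = carrier N' \<longrightarrow>
          (\<exists>h\<in>right_hom S M N. compose (carrier M) g h = f)))"


section \<open>Tensor products\<close>

text \<open>\<open>N \<otimes>\<^sub>S P\<close> is the free abelian group on \<open>N \<times> P\<close> modulo the subgroup generated by the
  usual relators. Balancedness over \<open>k\<close> has to be imposed as \<open>S\<close> need not have a unit.\<close>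

abbreviation pair_group ::
    "('k, 's, 'n, 'u) rmod_scheme \<Rightarrow> ('k, 's, 'r, 'p, 'v) bimod_scheme \<Rightarrow>
     ('n \<times> 'p \<Rightarrow>\<^sub>0 int) monoid"
  where "pair_group N P \<equiv> free_Abelian_group (carrier N \<times> carrier P)"

definition tensor_relators ::
    "('k, 'w) ring_scheme \<Rightarrow> ('s, 'z) ring_scheme \<Rightarrow> ('k, 's, 'n, 'u) rmod_scheme \<Rightarrow>
     ('k, 's, 'r, 'p, 'v) bimod_scheme \<Rightarrow> ('n \<times> 'p \<Rightarrow>\<^sub>0 int) set"
  where "tensor_relators k S N P =
    {frag_of (n \<oplus>\<^bsub>N\<^esub> n', p) - frag_of (n, p) - frag_of (n', p) | n n' p.
       n \<in> carrier N \<and> n' \<in> carrier N \<and> p \<in> carrier P} \<union>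
    {frag_of (n, p \<oplus>\<^bsub>P\<^esub> p') - frag_of (n, p) - frag_of (n, p') | n p p'.
       n \<in> carrier N \<and> p \<in> carrier P \<and> p' \<in> carrier P} \<union>
    {frag_of (n \<triangleleft>\<^bsub>N\<^esub> s, p) - frag_of (n, s \<triangleright>\<^bsub>P\<^esub> p) | n s p.
       n \<in> carrier N \<and> s \<in> carrier S \<and> p \<in> carrier P} \<union>
    {frag_of (c \<odot>\<^bsub>N\<^esub> n, p) - frag_of (n, c \<odot>\<^bsub>P\<^esub> p) | c n p.
       c \<in> carrier k \<and> n \<in> carrier N \<and> p \<in> carrier P}"

definition tensor_kernel ::
    "('k, 'w) ring_scheme \<Rightarrow> ('s, 'z) ring_scheme \<Rightarrow> ('k, 's, 'n, 'u) rmod_scheme \<Rightarrow>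
     ('k, 's, 'r, 'p, 'v) bimod_scheme \<Rightarrow> ('n \<times> 'p \<Rightarrow>\<^sub>0 int) set"
  where "tensor_kernel k S N P = generate (pair_group N P) (tensor_relators k S N P)"

definition tensor_class ::
    "('k, 'w) ring_scheme \<Rightarrow> ('s, 'z) ring_scheme \<Rightarrow> ('k, 's, 'n, 'u) rmod_scheme \<Rightarrow>
     ('k, 's, 'r, 'p, 'v) bimod_scheme \<Rightarrow> ('n \<times> 'p \<Rightarrow>\<^sub>0 int) \<Rightarrow> ('n \<times> 'p \<Rightarrow>\<^sub>0 int) set"
  where "tensor_class k S N P u = tensor_kernel k S N P #>\<^bsub>pair_group N P\<^esub> u"

abbreviation pure_tensor ::
    "('k, 'w) ring_scheme \<Rightarrow> ('s, 'z) ring_scheme \<Rightarrow> ('k, 's, 'n, 'u) rmod_scheme \<Rightarrow>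
     ('k, 's, 'r, 'p, 'v) bimod_scheme \<Rightarrow> 'n \<Rightarrow> 'p \<Rightarrow> ('n \<times> 'p \<Rightarrow>\<^sub>0 int) set"
  where "pure_tensor k S N P n p \<equiv> tensor_class k S N P (frag_of (n, p))"

text \<open>The map \<open>f \<otimes> h : N \<otimes>\<^sub>S P \<rightarrow> N' \<otimes>\<^sub>S\<^sub>' P'\<close>. It is meaningful only if the map on free abelian groups
  given by \<open>(n, p) \<mapsto> (f n, h p)\<close> respects the relations; see \<open>tensor_map_class\<close> and
  \<open>tensor_map_pure\<close> below.\<close>

definition tensor_map ::
    "('k, 'w) ring_scheme \<Rightarrow>
     ('s, 'z) ring_scheme \<Rightarrow> ('k, 's, 'n, 'u) rmod_scheme \<Rightarrow> ('k, 's, 'r, 'p, 'v) bimod_scheme \<Rightarrow>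
     ('t, 'z2) ring_scheme \<Rightarrow> ('k, 't, 'n2, 'u2) rmod_scheme \<Rightarrow> ('k, 't, 'r2, 'p2, 'v2) bimod_scheme \<Rightarrow>
     ('n \<Rightarrow> 'n2) \<Rightarrow> ('p \<Rightarrow> 'p2) \<Rightarrow> ('n \<times> 'p \<Rightarrow>\<^sub>0 int) set \<Rightarrow> ('n2 \<times> 'p2 \<Rightarrow>\<^sub>0 int) set"
  where "tensor_map k S N P S' N' P' f h =
    (\<lambda>C\<in>carrier (pair_group N P Mod tensor_kernel k S N P).
       the_elem ((\<lambda>u. tensor_class k S' N' P' (frag_extend (\<lambda>(n, p). frag_of (f n, h p)) u)) ` C))"

definition tensor ::
    "('k, 'w) ring_scheme \<Rightarrow> ('s, 'z) ring_scheme \<Rightarrow>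
     ('k, 'r, 's, 'n) bimod \<Rightarrow> ('k, 's, 't, 'p) bimod \<Rightarrow>
     ('k, 'r, 't, ('n \<times> 'p \<Rightarrow>\<^sub>0 int) set) bimod"
  where "tensor k S N P =
    \<lparr>carrier = carrier (pair_group N P Mod tensor_kernel k S N P),
     monoid.mult = undefined, monoid.one = undefined,
     ring.zero = \<one>\<^bsub>pair_group N P Mod tensor_kernel k S N P\<^esub>,
     ring.add = monoid.mult (pair_group N P Mod tensor_kernel k S N P),
     module.smult = (\<lambda>c. tensor_map k S N P S N P (\<lambda>n. c \<odot>\<^bsub>N\<^esub> n) (\<lambda>p. p)),
     ract = (\<lambda>C t. tensor_map k S N P S N P (\<lambda>n. n) (\<lambda>p. p \<triangleleft>\<^bsub>P\<^esub> t) C),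
     lact = (\<lambda>r. tensor_map k S N P S N P (\<lambda>n. r \<triangleright>\<^bsub>N\<^esub> n) (\<lambda>p. p))\<rparr>"

lemma tensor_relators_subset:
  assumes "right_module k S N" "left_module k S P"
  shows "tensor_relators k S N P \<subseteq> carrier (pair_group N P)"
proof -
  interpret N: right_module k S N by fact
  interpret P: left_module k S P by fact
  show ?thesis
    unfolding tensor_relators_def
    by (auto simp: N.ract_closed P.lact_closed dest!: subsetD [OF keys_diff])
qed

lemma tensor_kernel_subgroup:
  assumes "right_module k S N" "left_module k S P"
  shows "subgroup (tensor_kernel k S N P) (pair_group N P)"
  unfolding tensor_kernel_def
  using assms by (intro group.generate_is_subgroup tensor_relators_subset) simp_all

lemma tensor_class_eqI:
  assumes "right_module k S N" "left_module k S P"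
    and "u \<in> carrier (pair_group N P)" "v \<in> carrier (pair_group N P)"
    and "u - v \<in> tensor_kernel k S N P"
  shows "tensor_class k S N P u = tensor_class k S N P v"
proof -
  have "u \<in> tensor_kernel k S N P #>\<^bsub>pair_group N P\<^esub> v"
    using assms(5) by (force simp: r_coset_def)
  then show ?thesis
    unfolding tensor_class_def
    using group.repr_independence [OF group_free_Abelian_group _ assms(4) tensor_kernel_subgroup]
      assms by metis
qed

lemma tensor_map_class:
  fixes k :: "('k, 'w) ring_scheme"
    and N :: "('k, 's, 'n, 'u) rmod_scheme" and P :: "('k, 's, 'r, 'p, 'v) bimod_scheme"
    and N' :: "('k, 't, 'n2, 'u2) rmod_scheme" and P' :: "('k, 't, 'r2, 'p2, 'v2) bimod_scheme"
  assumes "right_module k S N" "left_module k S P" "right_module k S' N'" "left_module k S' P'"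
    and f: "f \<in> carrier N \<rightarrow> carrier N'"
      "\<And>n n'. \<lbrakk>n \<in> carrier N; n' \<in> carrier N\<rbrakk> \<Longrightarrow> f (n \<oplus>\<^bsub>N\<^esub> n') = f n \<oplus>\<^bsub>N'\<^esub> f n'"
      "\<And>c n. \<lbrakk>c \<in> carrier k; n \<in> carrier N\<rbrakk> \<Longrightarrow> f (c \<odot>\<^bsub>N\<^esub> n) = c \<odot>\<^bsub>N'\<^esub> f n"
    and h: "h \<in> carrier P \<rightarrow> carrier P'"
      "\<And>p p'. \<lbrakk>p \<in> carrier P; p' \<in> carrier P\<rbrakk> \<Longrightarrow> h (p \<oplus>\<^bsub>P\<^esub> p') = h p \<oplus>\<^bsub>P'\<^esub> h p'"
      "\<And>c p. \<lbrakk>c \<in> carrier k; p \<in> carrier P\<rbrakk> \<Longrightarrow> h (c \<odot>\<^bsub>P\<^esub> p) = c \<odot>\<^bsub>P'\<^esub> h p"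
    and bal: "\<And>n s p. \<lbrakk>n \<in> carrier N; s \<in> carrier S; p \<in> carrier P\<rbrakk> \<Longrightarrow>
      pure_tensor k S' N' P' (f (n \<triangleleft>\<^bsub>N\<^esub> s)) (h p) = pure_tensor k S' N' P' (f n) (h (s \<triangleright>\<^bsub>P\<^esub> p))"
    and u: "u \<in> carrier (pair_group N P)"
  shows "tensor_map k S N P S' N' P' f h (tensor_class k S N P u) =
    tensor_class k S' N' P' (frag_extend (\<lambda>(n, p). frag_of (f n, h p)) u)"
proof -
  interpret N: right_module k S N by fact
  interpret P: left_module k S P by fact
  interpret N': right_module k S' N' by fact
  interpret P': left_module k S' P' by fact
  define ext where "ext = frag_extend (\<lambda>(n, p). frag_of (f n, h p))"
  let ?K = "tensor_kernel k S N P" and ?K' = "tensor_kernel k S' N' P'"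
  have ext_closed: "ext v \<in> carrier (pair_group N' P')" if "v \<in> carrier (pair_group N P)" for v
    using that f(1) h(1) keys_frag_extend [of "\<lambda>(n, p). frag_of (f n, h p)" v]
    unfolding ext_def by fastforce
  have ext_diff: "ext (a - b) = ext a - ext b" and ext_add: "ext (a + b) = ext a + ext b" for a b
    by (simp_all add: ext_def frag_extend_diff frag_extend_add)
  have ext_of: "ext (frag_of (n, p)) = frag_of (f n, h p)" for n p
    by (simp add: ext_def)
  have K': "subgroup ?K' (pair_group N' P')"
    using assms by (intro tensor_kernel_subgroup)
  have K: "subgroup ?K (pair_group N P)"
    using assms by (intro tensor_kernel_subgroup)
  have rel: "ext v \<in> ?K'" if "v \<in> tensor_relators k S N P" for v
  proof -
    have incl: "w \<in> ?K'" if "w \<in> tensor_relators k S' N' P'" for w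
      using that unfolding tensor_kernel_def by (rule generate.incl)
    have balK: "frag_of (f (n \<triangleleft>\<^bsub>N\<^esub> s), h p) - frag_of (f n, h (s \<triangleright>\<^bsub>P\<^esub> p)) \<in> ?K'"
      if "n \<in> carrier N" "s \<in> carrier S" "p \<in> carrier P" for n s p
    proof -
      have 1: "frag_of (f (n \<triangleleft>\<^bsub>N\<^esub> s), h p) \<in> carrier (pair_group N' P')"
        and 2: "frag_of (f n, h (s \<triangleright>\<^bsub>P\<^esub> p)) \<in> carrier (pair_group N' P')"
        using f(1) h(1) that N.ract_closed P.lact_closed by auto
      have "frag_of (f (n \<triangleleft>\<^bsub>N\<^esub> s), h p) \<in> ?K' #>\<^bsub>pair_group N' P'\<^esub> frag_of (f n, h (s \<triangleright>\<^bsub>P\<^esub> p))"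
        using bal [OF that] group.rcos_self [OF group_free_Abelian_group 1 K']
        unfolding tensor_class_def by simp
      then show ?thesis by (auto simp: r_coset_def)
    qed
    from that show ?thesis
      unfolding tensor_relators_def
    proof (elim UnE CollectE exE conjE)
      fix n n' p
      assume "v = frag_of (n \<oplus>\<^bsub>N\<^esub> n', p) - frag_of (n, p) - frag_of (n', p)"
        and "n \<in> carrier N" "n' \<in> carrier N" "p \<in> carrier P"
      then have "ext v = frag_of (f n \<oplus>\<^bsub>N'\<^esub> f n', h p) - frag_of (f n, h p) - frag_of (f n', h p)"
        and "f n \<in> carrier N' \<and> f n' \<in> carrier N' \<and> h p \<in> carrier P'"
        using f(1) h(1) by (auto simp: ext_diff ext_of f(2))
      then show ?thesis
        by (intro incl) (unfold tensor_relators_def, blast)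
    next
      fix n p p'
      assume "v = frag_of (n, p \<oplus>\<^bsub>P\<^esub> p') - frag_of (n, p) - frag_of (n, p')"
        and "n \<in> carrier N" "p \<in> carrier P" "p' \<in> carrier P"
      then have "ext v = frag_of (f n, h p \<oplus>\<^bsub>P'\<^esub> h p') - frag_of (f n, h p) - frag_of (f n, h p')"
        and "f n \<in> carrier N' \<and> h p \<in> carrier P' \<and> h p' \<in> carrier P'"
        using f(1) h(1) by (auto simp: ext_diff ext_of h(2))
      then show ?thesis
        by (intro incl) (unfold tensor_relators_def, blast)
    next
      fix n s p
      assume "v = frag_of (n \<triangleleft>\<^bsub>N\<^esub> s, p) - frag_of (n, s \<triangleright>\<^bsub>P\<^esub> p)"
        and "n \<in> carrier N" "s \<in> carrier S" "p \<in> carrier P"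
      then show ?thesis
        by (simp add: ext_diff ext_of balK)
    next
      fix c n p
      assume "v = frag_of (c \<odot>\<^bsub>N\<^esub> n, p) - frag_of (n, c \<odot>\<^bsub>P\<^esub> p)"
        and "c \<in> carrier k" "n \<in> carrier N" "p \<in> carrier P"
      then have "ext v = frag_of (c \<odot>\<^bsub>N'\<^esub> f n, h p) - frag_of (f n, c \<odot>\<^bsub>P'\<^esub> h p)"
        and "c \<in> carrier k \<and> f n \<in> carrier N' \<and> h p \<in> carrier P'"
        using f(1) h(1) by (auto simp: ext_diff ext_of f(3) h(3))
      then show ?thesis
        by (intro incl) (unfold tensor_relators_def, blast)
    qed
  qed
  have ker: "ext v \<in> ?K'" if "v \<in> ?K" for v
    using that unfolding tensor_kernel_def [of k S N P]
  proof (induction v rule: generate.induct)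
    case one
    then show ?case using subgroup.one_closed [OF K'] by (simp add: ext_def)
  next
    case (incl v)
    then show ?case by (rule rel)
  next
    case (inv v)
    then have v: "v \<in> carrier (pair_group N P)"
      using tensor_relators_subset [OF assms(1,2)] by (rule subsetD [rotated])
    have "inv\<^bsub>pair_group N' P'\<^esub> (ext v) \<in> ?K'"
      by (rule subgroup.m_inv_closed [OF K' rel [OF inv]])
    then have "- ext v \<in> ?K'"
      using ext_closed [OF v] by simp
    then show ?case
      using v by (simp add: ext_def frag_extend_minus)
  next
    case (eng v w)
    then show ?case using subgroup.m_closed [OF K'] by (simp add: ext_add)
  qed
  have const: "tensor_class k S' N' P' (ext v) = tensor_class k S' N' P' (ext u)"
    if "v \<in> tensor_class k S N P u" for v
  proof (rule tensor_class_eqI)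
    obtain a where a: "a \<in> ?K" "v = a + u"
      using \<open>v \<in> tensor_class k S N P u\<close> by (auto simp: tensor_class_def r_coset_def)
    then show "ext v - ext u \<in> ?K'"
      by (simp add: ext_add ker)
    have "a \<in> carrier (pair_group N P)"
      using a(1) subgroup.subset [OF K] by blast
    with a(2) u have "v \<in> carrier (pair_group N P)"
      using keys_add [of a u] by auto
    then show "ext v \<in> carrier (pair_group N' P')"
      by (rule ext_closed)
  qed (use assms ext_closed u in auto)
  have "u \<in> tensor_class k S N P u"
    unfolding tensor_class_def by (rule group.rcos_self [OF group_free_Abelian_group u K])
  then have "(\<lambda>v. tensor_class k S' N' P' (ext v)) ` tensor_class k S N P u =
      {tensor_class k S' N' P' (ext u)}"
    using const by blast
  moreover have "tensor_class k S N P u \<in> carrier (pair_group N P Mod ?K)"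
    using u by (auto simp: carrier_FactGroup tensor_class_def)
  ultimately show ?thesis
    by (simp add: tensor_map_def ext_def)
qed

lemma tensor_map_pure:
  fixes k :: "('k, 'w) ring_scheme"
    and N :: "('k, 's, 'n, 'u) rmod_scheme" and P :: "('k, 's, 'r, 'p, 'v) bimod_scheme"
    and N' :: "('k, 't, 'n2, 'u2) rmod_scheme" and P' :: "('k, 't, 'r2, 'p2, 'v2) bimod_scheme"
  assumes "right_module k S N" "left_module k S P" "right_module k S' N'" "left_module k S' P'"
    and "f \<in> carrier N \<rightarrow> carrier N'"
      "\<And>n n'. \<lbrakk>n \<in> carrier N; n' \<in> carrier N\<rbrakk> \<Longrightarrow> f (n \<oplus>\<^bsub>N\<^esub> n') = f n \<oplus>\<^bsub>N'\<^esub> f n'"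
      "\<And>c n. \<lbrakk>c \<in> carrier k; n \<in> carrier N\<rbrakk> \<Longrightarrow> f (c \<odot>\<^bsub>N\<^esub> n) = c \<odot>\<^bsub>N'\<^esub> f n"
    and "h \<in> carrier P \<rightarrow> carrier P'"
      "\<And>p p'. \<lbrakk>p \<in> carrier P; p' \<in> carrier P\<rbrakk> \<Longrightarrow> h (p \<oplus>\<^bsub>P\<^esub> p') = h p \<oplus>\<^bsub>P'\<^esub> h p'"
      "\<And>c p. \<lbrakk>c \<in> carrier k; p \<in> carrier P\<rbrakk> \<Longrightarrow> h (c \<odot>\<^bsub>P\<^esub> p) = c \<odot>\<^bsub>P'\<^esub> h p"
    and "\<And>n s p. \<lbrakk>n \<in> carrier N; s \<in> carrier S; p \<in> carrier P\<rbrakk> \<Longrightarrow>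
      pure_tensor k S' N' P' (f (n \<triangleleft>\<^bsub>N\<^esub> s)) (h p) = pure_tensor k S' N' P' (f n) (h (s \<triangleright>\<^bsub>P\<^esub> p))"
    and "n \<in> carrier N" "p \<in> carrier P"
  shows "tensor_map k S N P S' N' P' f h (pure_tensor k S N P n p) =
    pure_tensor k S' N' P' (f n) (h p)"
  by (subst tensor_map_class) (use assms in auto)


section \<open>Firm modules, duals and local units\<close>

definition regular :: "('k, 'b) module \<Rightarrow> ('k, 'b, 'b, 'b) bimod"
  where "regular B =
    \<lparr>carrier = carrier B, monoid.mult = monoid.mult B, monoid.one = \<one>\<^bsub>B\<^esub>,
     ring.zero = \<zero>\<^bsub>B\<^esub>, ring.add = ring.add B,
     module.smult = module.smult B, ract = monoid.mult B, lact = monoid.mult B\<rparr>"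

text \<open>Pure tensors generate \<open>B \<otimes>\<^sub>B P\<close>, so the \<open>f\<close> below can only be the canonical map.\<close>

definition left_firm ::
    "('k, 'w) ring_scheme \<Rightarrow> ('k, 'b) module \<Rightarrow> ('k, 'b, 'a, 'p) bimod \<Rightarrow> bool"
  where "left_firm k B P \<longleftrightarrow>
    (\<exists>f\<in>iso (add_monoid (tensor k B (regular B) P)) (add_monoid P).
       \<forall>b\<in>carrier B. \<forall>p\<in>carrier P. f (pure_tensor k B (regular B) P b p) = b \<triangleright>\<^bsub>P\<^esub> p)"

definition dual :: "('k, 'a) module \<Rightarrow> ('k, 'b, 'a, 'p) bimod \<Rightarrow> ('k, 'a, 'b, 'p \<Rightarrow> 'a) bimod"
  where "dual A P =
    \<lparr>carrier = right_hom A P (regular A), monoid.mult = undefined, monoid.one = undefined,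
     ring.zero = (\<lambda>p\<in>carrier P. \<zero>\<^bsub>A\<^esub>),
     ring.add = (\<lambda>\<phi> \<psi>. \<lambda>p\<in>carrier P. \<phi> p \<oplus>\<^bsub>A\<^esub> \<psi> p),
     module.smult = (\<lambda>c \<phi>. \<lambda>p\<in>carrier P. c \<odot>\<^bsub>A\<^esub> \<phi> p),
     ract = (\<lambda>\<phi> b. \<lambda>p\<in>carrier P. \<phi> (b \<triangleright>\<^bsub>P\<^esub> p)),
     lact = (\<lambda>a \<phi>. \<lambda>p\<in>carrier P. a \<otimes>\<^bsub>A\<^esub> \<phi> p)\<rparr>"

definition idempotent_local_units :: "('k, 'b) module \<Rightarrow> 'i set \<Rightarrow> ('i \<Rightarrow> 'b) \<Rightarrow> bool"
  where "idempotent_local_units B I e \<longleftrightarrow>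
    e \<in> I \<rightarrow> carrier B \<and> inj_on e I \<and> (\<forall>i\<in>I. e i \<otimes>\<^bsub>B\<^esub> e i = e i) \<and>
    (\<forall>F. finite F \<and> F \<subseteq> carrier B \<longrightarrow>
       (\<exists>i\<in>I. \<forall>b\<in>F. e i \<otimes>\<^bsub>B\<^esub> b = b \<and> b \<otimes>\<^bsub>B\<^esub> e i = b))"

definition idem_le :: "('k, 'b) module \<Rightarrow> ('i \<Rightarrow> 'b) \<Rightarrow> 'i \<Rightarrow> 'i \<Rightarrow> bool"
  where "idem_le B e i j \<longleftrightarrow> e i \<otimes>\<^bsub>B\<^esub> e j = e i \<and> e j \<otimes>\<^bsub>B\<^esub> e i = e i"

definition corner :: "('k, 'b) module \<Rightarrow> ('i \<Rightarrow> 'b) \<Rightarrow> 'i \<Rightarrow> ('k, 'b) module"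
  where "corner B e i =
    B\<lparr>carrier := (\<lambda>b. e i \<otimes>\<^bsub>B\<^esub> b \<otimes>\<^bsub>B\<^esub> e i) ` carrier B, monoid.one := e i\<rparr>"

definition component :: "('k, 'b, 'a, 'p) bimod \<Rightarrow> ('i \<Rightarrow> 'b) \<Rightarrow> 'i \<Rightarrow> ('k, 'b, 'a, 'p) bimod"
  where "component P e i = P\<lparr>carrier := (\<lambda>p. e i \<triangleright>\<^bsub>P\<^esub> p) ` carrier P\<rparr>"

text \<open>The maps \<open>\<sigma>\<^sub>j\<^sub>i\<close> and \<open>\<sigma>\<^sub>i\<close> (which differ only in their codomain), \<open>\<tau>\<^sub>i\<^sub>j\<close> and \<open>\<tau>\<^sub>i\<close>.\<close>

definition incl :: "('k, 'b, 'a, 'p) bimod \<Rightarrow> ('i \<Rightarrow> 'b) \<Rightarrow> 'i \<Rightarrow> 'p \<Rightarrow> 'p"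
  where "incl P e i = (\<lambda>p\<in>carrier (component P e i). p)"

definition proj_between :: "('k, 'b, 'a, 'p) bimod \<Rightarrow> ('i \<Rightarrow> 'b) \<Rightarrow> 'i \<Rightarrow> 'i \<Rightarrow> 'p \<Rightarrow> 'p"
  where "proj_between P e i j = (\<lambda>p\<in>carrier (component P e j). e i \<triangleright>\<^bsub>P\<^esub> p)"

definition proj :: "('k, 'b, 'a, 'p) bimod \<Rightarrow> ('i \<Rightarrow> 'b) \<Rightarrow> 'i \<Rightarrow> 'p \<Rightarrow> 'p"
  where "proj P e i = (\<lambda>p\<in>carrier P. e i \<triangleright>\<^bsub>P\<^esub> p)"

definition dagger ::
    "('k, 'a) module \<Rightarrow> ('k, 'b, 'a, 'p) bimod \<Rightarrow> 'i set \<Rightarrow> ('i \<Rightarrow> 'b) \<Rightarrow>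
     ('k, 'a, 'b, 'p \<Rightarrow> 'a) bimod"
  where "dagger A P I e = (dual A P)\<lparr>carrier :=
    {\<phi> \<in> carrier (dual A P). \<exists>i\<in>I.
       \<phi> = compose (carrier P) (compose (carrier (component P e i)) \<phi> (incl P e i)) (proj P e i)}\<rparr>"


section \<open>Direct systems of bimodules and their colimits\<close>

definition direct_system ::
    "('k, 'w) ring_scheme \<Rightarrow> ('k, 'a) module \<Rightarrow> 'i set \<Rightarrow> ('i \<Rightarrow> 'i \<Rightarrow> bool) \<Rightarrow>
     ('i \<Rightarrow> ('k, 'a, 'a, 'm) bimod) \<Rightarrow> ('i \<Rightarrow> 'i \<Rightarrow> 'm \<Rightarrow> 'm) \<Rightarrow> bool"
  where "direct_system k A I prec G T \<longleftrightarrow>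
    (\<forall>i\<in>I. unital_bimodule k A (G i)) \<and>
    (\<forall>i\<in>I. \<forall>j\<in>I. prec i j \<longrightarrow> T j i \<in> bimod_hom k A A (G i) (G j)) \<and>
    (\<forall>i\<in>I. T i i = (\<lambda>x\<in>carrier (G i). x)) \<and>
    (\<forall>i\<in>I. \<forall>j\<in>I. \<forall>l\<in>I. prec i j \<and> prec j l \<longrightarrow> T l i = compose (carrier (G i)) (T l j) (T j i))"

definition cocone ::
    "('k, 'w) ring_scheme \<Rightarrow> ('k, 'a) module \<Rightarrow> 'i set \<Rightarrow> ('i \<Rightarrow> 'i \<Rightarrow> bool) \<Rightarrow>
     ('i \<Rightarrow> ('k, 'a, 'a, 'm) bimod) \<Rightarrow> ('i \<Rightarrow> 'i \<Rightarrow> 'm \<Rightarrow> 'm) \<Rightarrow>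
     ('k, 'a, 'a, 'q) bimod \<Rightarrow> ('i \<Rightarrow> 'm \<Rightarrow> 'q) \<Rightarrow> bool"
  where "cocone k A I prec G T Q h \<longleftrightarrow>
    unital_bimodule k A Q \<and>
    (\<forall>i\<in>I. h i \<in> bimod_hom k A A (G i) Q) \<and>
    (\<forall>i\<in>I. \<forall>j\<in>I. prec i j \<longrightarrow> compose (carrier (G i)) (h j) (T j i) = h i)"

text \<open>The argument of type \<^typ>\<open>'q itself\<close> is the carrier type of the test objects. A theorem stated
  for a type variable \<open>'q\<close> asserts the universal property with respect to all bimodules.\<close>

definition is_colimit ::
    "'q itself \<Rightarrow> 'k ring \<Rightarrow> ('k, 'a) module \<Rightarrow> 'i set \<Rightarrow> ('i \<Rightarrow> 'i \<Rightarrow> bool) \<Rightarrow>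
     ('i \<Rightarrow> ('k, 'a, 'a, 'm) bimod) \<Rightarrow> ('i \<Rightarrow> 'i \<Rightarrow> 'm \<Rightarrow> 'm) \<Rightarrow>
     ('k, 'a, 'a, 'l) bimod \<Rightarrow> ('i \<Rightarrow> 'm \<Rightarrow> 'l) \<Rightarrow> bool"
  where "is_colimit TYPE('q) k A I prec G T L g \<longleftrightarrow>
    direct_system k A I prec G T \<and>
    cocone k A I prec G T L g \<and>
    (\<forall>(Q :: ('k, 'a, 'a, 'q) bimod) h. cocone k A I prec G T Q h \<longrightarrow>
       (\<exists>!v. v \<in> bimod_hom k A A L Q \<and> (\<forall>i\<in>I. compose (carrier (G i)) v (g i) = h i)))"


section \<open>The direct system of the comatrix bimodules and its cocone\<close>

definition G_obj ::
    "'k ring \<Rightarrow> ('k, 'a) module \<Rightarrow> ('k, 'b) module \<Rightarrow> ('k, 'b, 'a, 'p) bimod \<Rightarrow> ('i \<Rightarrow> 'b) \<Rightarrow> 'i \<Rightarrow>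
     ('k, 'a, 'a, (('p \<Rightarrow> 'a) \<times> 'p \<Rightarrow>\<^sub>0 int) set) bimod"
  where "G_obj k A B P e i =
    tensor k (corner B e i) (dual A (component P e i)) (component P e i)"

definition G_map ::
    "'k ring \<Rightarrow> ('k, 'a) module \<Rightarrow> ('k, 'b) module \<Rightarrow> ('k, 'b, 'a, 'p) bimod \<Rightarrow> ('i \<Rightarrow> 'b) \<Rightarrow> 'i \<Rightarrow> 'i \<Rightarrow>
     (('p \<Rightarrow> 'a) \<times> 'p \<Rightarrow>\<^sub>0 int) set \<Rightarrow> (('p \<Rightarrow> 'a) \<times> 'p \<Rightarrow>\<^sub>0 int) set"
  where "G_map k A B P e j i =
    tensor_map k
      (corner B e i) (dual A (component P e i)) (component P e i)
      (corner B e j) (dual A (component P e j)) (component P e j)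
      (\<lambda>\<phi>. compose (carrier (component P e j)) \<phi> (proj_between P e i j)) (incl P e i)"

definition g_map ::
    "'k ring \<Rightarrow> ('k, 'a) module \<Rightarrow> ('k, 'b) module \<Rightarrow> ('k, 'b, 'a, 'p) bimod \<Rightarrow> 'i set \<Rightarrow> ('i \<Rightarrow> 'b) \<Rightarrow> 'i \<Rightarrow>
     (('p \<Rightarrow> 'a) \<times> 'p \<Rightarrow>\<^sub>0 int) set \<Rightarrow> (('p \<Rightarrow> 'a) \<times> 'p \<Rightarrow>\<^sub>0 int) set"
  where "g_map k A B P I e i =
    tensor_map k
      (corner B e i) (dual A (component P e i)) (component P e i)
      B (dagger A P I e) P
      (\<lambda>\<phi>. compose (carrier P) \<phi> (proj P e i)) (incl P e i)"

end

theory Submission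
  imports Defs
begin

text \<open>
  Everything rests on one observation: any finite collection of elements \<open>b\<close> of \<open>B\<close>, \<open>p\<close> of \<open>P\<close> and
  \<open>\<phi>\<close> of \<open>P\<^sup>\<dagger>\<close> is fixed by a single local unit \<open>e\<^sub>i\<close>, in the sense that \<open>e\<^sub>i b = b = b e\<^sub>i\<close>,
  \<open>e\<^sub>i p = p\<close> and \<open>\<phi> (e\<^sub>i _) = \<phi>\<close> (\<open>common_unit\<close>). For \<open>b\<close> this is the definition of local units,
  for \<open>\<phi>\<close> it is the definition of \<open>P\<^sup>\<dagger>\<close>, and for \<open>p\<close> it follows from firmness, which writes \<open>p\<close> as
  a finite sum of elements \<open>b q\<close>. In particular the index set is directed.

  Restriction to \<open>P\<^sub>i\<close> and composition with \<open>\<tau>\<^sub>i\<close> identify \<open>P\<^sub>i\<^sup>*\<close> with the functionals in \<open>P\<^sup>\<dagger>\<close>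
  fixed by \<open>e\<^sub>i\<close>, and \<open>P\<^sub>i\<close> consists of the elements of \<open>P\<close> fixed by \<open>e\<^sub>i\<close>. Hence a pure tensor
  \<open>\<phi> \<otimes> p\<close> in \<open>P\<^sup>\<dagger> \<otimes>\<^sub>B P\<close> is the image under \<open>g\<^sub>i\<close> of \<open>\<phi>|P\<^sub>i \<otimes> p\<close> as soon as \<open>e\<^sub>i\<close> fixes \<open>\<phi>\<close>
  and \<open>p\<close>. So a morphism out of \<open>P\<^sup>\<dagger> \<otimes>\<^sub>B P\<close> is determined by its composites with the \<open>g\<^sub>i\<close>. Conversely,
  given a cocone \<open>h\<close>, put \<open>\<beta> (\<phi>, p) = h\<^sub>i (\<phi>|P\<^sub>i \<otimes> p)\<close> for any such \<open>i\<close>. Passing to a larger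
  index does not change the value, because \<open>h\<close> is a cocone, and so by directedness the choice of \<open>i\<close>
  is immaterial (\<open>h_pure_unique\<close>). Each of the identities that make \<open>\<beta>\<close> biadditive, balanced over
  \<open>B\<close> and compatible with the actions of \<open>k\<close> and \<open>A\<close> involves finitely many elements, so it can be
  checked at one index (\<open>h_bil_ops\<close>), where it holds in \<open>P\<^sub>i\<^sup>* \<otimes>\<^bsub>B\<^sub>i\<^esub> P\<^sub>i\<close>. The morphism that \<open>\<beta>\<close> induces
  is the required factorization (\<open>factorization\<close>).

  The remaining work is to see that the objects are unital bimodules and that the maps are well-defined
  morphisms. Maps out of a tensor product are handled throughout by two principles: a bilinear
  balanced map induces an additive map (\<open>tensor_lift\<close>), and a property compatible with sums holds as
  soon as it holds for pure tensors (\<open>tensor_induct\<close>).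
\<close>

section \<open>The tensor product as an abelian group\<close>

locale tensor_product = N: right_module k S N + P: left_module k S P
  for k :: "('k, 'w) ring_scheme" and S :: "('k, 's, 'x) module_scheme"
    and N :: "('k, 'r, 's, 'n) bimod" and P :: "('k, 's, 't, 'p) bimod"
begin

abbreviation "T \<equiv> tensor k S N P"
abbreviation "cls \<equiv> tensor_class k S N P"
abbreviation "pure \<equiv> pure_tensor k S N P"

lemma kernel_normal: "tensor_kernel k S N P \<lhd> pair_group N P"
  using comm_group.subgroup_imp_normal [OF abelian_free_Abelian_group]
    tensor_kernel_subgroup [OF N.right_module_axioms P.left_module_axioms] by blast

lemma carrier_tensor: "carrier T = cls ` carrier (pair_group N P)"
  by (simp add: tensor_def carrier_FactGroup tensor_class_def)

lemma cls_closed: "u \<in> carrier (pair_group N P) \<Longrightarrow> cls u \<in> carrier T"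
  unfolding carrier_tensor by (rule imageI)

lemma cls_add:
  assumes "u \<in> carrier (pair_group N P)" "v \<in> carrier (pair_group N P)"
  shows "cls (u + v) = cls u \<oplus>\<^bsub>T\<^esub> cls v"
  using normal.rcos_sum [OF kernel_normal assms] by (simp add: tensor_def tensor_class_def)

lemma zero_tensor: "\<zero>\<^bsub>T\<^esub> = cls 0"
  using group.coset_mult_one [OF group_free_Abelian_group, of "tensor_kernel k S N P" "carrier N \<times> carrier P"]
    subgroup.subset [OF normal_imp_subgroup [OF kernel_normal]]
  by (simp add: tensor_def tensor_class_def)

lemma abelian_group_tensor: "abelian_group T"
proof -
  interpret Q: comm_group "pair_group N P Mod tensor_kernel k S N P"
    by (intro comm_group.abelian_FactGroup abelian_free_Abelian_group
        normal_imp_subgroup kernel_normal)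
  show ?thesis
    by (rule abelian_groupI)
      (use Q.m_closed Q.one_closed Q.m_assoc Q.m_comm Q.l_one Q.l_inv_ex
        in \<open>simp_all add: tensor_def\<close>)
qed

sublocale T: abelian_group T by (rule abelian_group_tensor)

lemma pure_closed [simp]: "\<lbrakk>n \<in> carrier N; p \<in> carrier P\<rbrakk> \<Longrightarrow> pure n p \<in> carrier T"
  by (rule cls_closed) simp

lemma cls_eqI:
  assumes "u \<in> carrier (pair_group N P)" "v \<in> carrier (pair_group N P)"
    and "u - v \<in> tensor_relators k S N P"
  shows "cls u = cls v"
  using assms N.right_module_axioms P.left_module_axioms
  by (intro tensor_class_eqI) (auto simp: tensor_kernel_def intro: generate.incl)

lemma pure_add_left:
  assumes "n \<in> carrier N" "n' \<in> carrier N" "p \<in> carrier P"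
  shows "pure (n \<oplus>\<^bsub>N\<^esub> n') p = pure n p \<oplus>\<^bsub>T\<^esub> pure n' p"
proof -
  have "cls (frag_of (n \<oplus>\<^bsub>N\<^esub> n', p)) = cls (frag_of (n, p) + frag_of (n', p))"
    using assms
    by (intro cls_eqI) (auto simp: tensor_relators_def algebra_simps dest!: subsetD [OF keys_add])
  then show ?thesis
    using assms by (simp add: cls_add)
qed

lemma pure_add_right:
  assumes "n \<in> carrier N" "p \<in> carrier P" "p' \<in> carrier P"
  shows "pure n (p \<oplus>\<^bsub>P\<^esub> p') = pure n p \<oplus>\<^bsub>T\<^esub> pure n p'"
proof -
  have "cls (frag_of (n, p \<oplus>\<^bsub>P\<^esub> p')) = cls (frag_of (n, p) + frag_of (n, p'))"
    using assms
    by (intro cls_eqI) (auto simp: tensor_relators_def algebra_simps dest!: subsetD [OF keys_add])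
  then show ?thesis
    using assms by (simp add: cls_add)
qed

lemma pure_balanced:
  assumes "n \<in> carrier N" "s \<in> carrier S" "p \<in> carrier P"
  shows "pure (n \<triangleleft>\<^bsub>N\<^esub> s) p = pure n (s \<triangleright>\<^bsub>P\<^esub> p)"
  using assms N.ract_closed P.lact_closed
  by (intro cls_eqI) (simp_all add: tensor_relators_def, blast)

lemma pure_smult:
  assumes "c \<in> carrier k" "n \<in> carrier N" "p \<in> carrier P"
  shows "pure (c \<odot>\<^bsub>N\<^esub> n) p = pure n (c \<odot>\<^bsub>P\<^esub> p)"
  using assms by (intro cls_eqI) (simp_all add: tensor_relators_def, blast)

lemma pure_zero_left:
  assumes "p \<in> carrier P" shows "pure \<zero>\<^bsub>N\<^esub> p = \<zero>\<^bsub>T\<^esub>"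
  using pure_add_left [of "\<zero>\<^bsub>N\<^esub>" "\<zero>\<^bsub>N\<^esub>" p] assms
  by (simp add: T.add.l_cancel_one)

text \<open>A negative pure tensor is again pure, so pure tensors generate the tensor product already as a
  monoid. This is what reduces the induction principle below to pure tensors and sums.\<close>

lemma pure_minus_left:
  assumes "n \<in> carrier N" "p \<in> carrier P"
  shows "pure (\<ominus>\<^bsub>N\<^esub> n) p = cls (- frag_of (n, p))"
proof -
  have "pure (\<ominus>\<^bsub>N\<^esub> n) p \<oplus>\<^bsub>T\<^esub> pure n p = \<zero>\<^bsub>T\<^esub>"
    using assms by (simp flip: pure_add_left add: pure_zero_left N.M.l_neg)
  moreover have "cls (- frag_of (n, p)) \<oplus>\<^bsub>T\<^esub> pure n p = \<zero>\<^bsub>T\<^esub>"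
    using assms by (simp flip: cls_add add: zero_tensor)
  moreover have "cls (- frag_of (n, p)) \<in> carrier T"
    using assms by (intro cls_closed) simp
  ultimately show ?thesis
    using assms by (metis T.add.inv_unique' T.minus_equality N.add.inv_closed pure_closed)
qed

lemma tensor_induct [consumes 1, case_names pure add]:
  assumes x: "x \<in> carrier T"
    and pure: "\<And>n p. \<lbrakk>n \<in> carrier N; p \<in> carrier P\<rbrakk> \<Longrightarrow> Q (pure n p)"
    and add: "\<And>x y. \<lbrakk>x \<in> carrier T; y \<in> carrier T; Q x; Q y\<rbrakk> \<Longrightarrow> Q (x \<oplus>\<^bsub>T\<^esub> y)"
  shows "Q x"
proof -
  obtain u where u: "Poly_Mapping.keys u \<subseteq> carrier N \<times> carrier P" and [simp]: "x = cls u"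
    using x by (auto simp: carrier_tensor)
  \<comment> \<open>Induction on the free abelian group builds differences, so \<open>- u\<close> has to be carried along.\<close>
  from u have "Q (cls u) \<and> Q (cls (- u))"
  proof (induction u rule: free_Abelian_group_induct [consumes 1, case_names zero diff of])
    case zero
    show ?case
      using pure [of "\<zero>\<^bsub>N\<^esub>" "\<zero>\<^bsub>P\<^esub>"] by (simp add: pure_zero_left zero_tensor)
  next
    case (diff u v)
    then have "cls (u - v) = cls u \<oplus>\<^bsub>T\<^esub> cls (- v)" "cls (- (u - v)) = cls v \<oplus>\<^bsub>T\<^esub> cls (- u)"
      by (simp_all flip: cls_add)
    moreover have "cls u \<in> carrier T" "cls v \<in> carrier T" "cls (- u) \<in> carrier T" "cls (- v) \<in> carrier T"
      using diff by (simp_all add: cls_closed)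
    ultimately show ?case using diff add by simp
  next
    case (of a)
    then obtain n p where "a = (n, p)" "n \<in> carrier N" "p \<in> carrier P" by auto
    then show ?case
      using pure [of n p] pure [of "\<ominus>\<^bsub>N\<^esub> n" p] by (simp add: pure_minus_left)
  qed
  then show ?thesis by simp
qed

lemma additive_eqI:
  assumes "\<And>x y. \<lbrakk>x \<in> carrier T; y \<in> carrier T\<rbrakk> \<Longrightarrow> f (x \<oplus>\<^bsub>T\<^esub> y) = f x \<oplus>\<^bsub>Q\<^esub> f y"
    and "\<And>x y. \<lbrakk>x \<in> carrier T; y \<in> carrier T\<rbrakk> \<Longrightarrow> g (x \<oplus>\<^bsub>T\<^esub> y) = g x \<oplus>\<^bsub>Q\<^esub> g y"
    and "\<And>n p. \<lbrakk>n \<in> carrier N; p \<in> carrier P\<rbrakk> \<Longrightarrow> f (pure n p) = g (pure n p)"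
    and "x \<in> carrier T"
  shows "f x = g x"
  using assms(4) by (induction rule: tensor_induct) (simp_all add: assms)

text \<open>A map on pairs extends to the free abelian group; being biadditive and balanced it kills the
  relators, hence the subgroup that they generate, and so it factors through the quotient. The factor
  is made extensional, as morphisms are.\<close>

lemma tensor_lift:
  fixes Q :: "('q, 'z) ring_scheme" and \<beta> :: "'n \<Rightarrow> 'p \<Rightarrow> 'q"
  assumes Q: "abelian_group Q"
    and closed: "\<And>n p. \<lbrakk>n \<in> carrier N; p \<in> carrier P\<rbrakk> \<Longrightarrow> \<beta> n p \<in> carrier Q"
    and add_l: "\<And>n n' p. \<lbrakk>n \<in> carrier N; n' \<in> carrier N; p \<in> carrier P\<rbrakk> \<Longrightarrow>
      \<beta> (n \<oplus>\<^bsub>N\<^esub> n') p = \<beta> n p \<oplus>\<^bsub>Q\<^esub> \<beta> n' p"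
    and add_r: "\<And>n p p'. \<lbrakk>n \<in> carrier N; p \<in> carrier P; p' \<in> carrier P\<rbrakk> \<Longrightarrow>
      \<beta> n (p \<oplus>\<^bsub>P\<^esub> p') = \<beta> n p \<oplus>\<^bsub>Q\<^esub> \<beta> n p'"
    and bal: "\<And>n s p. \<lbrakk>n \<in> carrier N; s \<in> carrier S; p \<in> carrier P\<rbrakk> \<Longrightarrow>
      \<beta> (n \<triangleleft>\<^bsub>N\<^esub> s) p = \<beta> n (s \<triangleright>\<^bsub>P\<^esub> p)"
    and smult: "\<And>c n p. \<lbrakk>c \<in> carrier k; n \<in> carrier N; p \<in> carrier P\<rbrakk> \<Longrightarrow>
      \<beta> (c \<odot>\<^bsub>N\<^esub> n) p = \<beta> n (c \<odot>\<^bsub>P\<^esub> p)"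
  obtains f where "f \<in> carrier T \<rightarrow>\<^sub>E carrier Q"
    and "\<And>x y. \<lbrakk>x \<in> carrier T; y \<in> carrier T\<rbrakk> \<Longrightarrow> f (x \<oplus>\<^bsub>T\<^esub> y) = f x \<oplus>\<^bsub>Q\<^esub> f y"
    and "\<And>n p. \<lbrakk>n \<in> carrier N; p \<in> carrier P\<rbrakk> \<Longrightarrow> f (pure n p) = \<beta> n p"
proof -
  interpret Q: abelian_group Q by fact
  let ?F = "pair_group N P"
  have "case_prod \<beta> ` (carrier N \<times> carrier P) \<subseteq> carrier (add_monoid Q)"
    using closed by auto
  then obtain h where h: "h \<in> hom ?F (add_monoid Q)"
    and h_of: "\<And>z. z \<in> carrier N \<times> carrier P \<Longrightarrow> h (frag_of z) = case_prod \<beta> z"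
    using comm_group.free_Abelian_group_universal [OF Q.a_comm_group] by metis
  interpret h: group_hom ?F "add_monoid Q" h
    using h Q.add.is_group by (intro group_hom.intro group_hom_axioms.intro) auto
  have h_diff: "h (u - v) = h u \<ominus>\<^bsub>Q\<^esub> h v" if "u \<in> carrier ?F" "v \<in> carrier ?F" for u v
    using h.hom_mult [of u "- v"] h.hom_inv [of v] that
    by (simp add: a_minus_def a_inv_def)
  have cancel: "x \<oplus>\<^bsub>Q\<^esub> y \<ominus>\<^bsub>Q\<^esub> x \<ominus>\<^bsub>Q\<^esub> y = \<zero>\<^bsub>Q\<^esub>" if "x \<in> carrier Q" "y \<in> carrier Q" for x y
    using that by (simp add: a_minus_def Q.a_comm [of x y] Q.a_assoc Q.r_neg)
  have diff_carrier: "frag_of a - frag_of b \<in> carrier ?F"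
    if "a \<in> carrier N \<times> carrier P" "b \<in> carrier N \<times> carrier P" for a b
    using that keys_diff [of "frag_of a" "frag_of b"] by auto
  have "h u = \<zero>\<^bsub>Q\<^esub>" if "u \<in> tensor_relators k S N P" for u
  proof -
    have triple: "h (frag_of a - frag_of b - frag_of c) = \<zero>\<^bsub>Q\<^esub>"
      if "a \<in> carrier N \<times> carrier P" "b \<in> carrier N \<times> carrier P" "c \<in> carrier N \<times> carrier P"
        "case_prod \<beta> a = case_prod \<beta> b \<oplus>\<^bsub>Q\<^esub> case_prod \<beta> c" for a b c
    proof -
      have "case_prod \<beta> b \<in> carrier Q" "case_prod \<beta> c \<in> carrier Q"
        using that closed by auto
      then show ?thesis
        using that diff_carrier
        by (simp add: h_diff h_of cancel del: carrier_free_Abelian_group_iff)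
    qed
    have double: "h (frag_of a - frag_of b) = \<zero>\<^bsub>Q\<^esub>"
      if "a \<in> carrier N \<times> carrier P" "b \<in> carrier N \<times> carrier P" "case_prod \<beta> a = case_prod \<beta> b" for a b
    proof -
      have "case_prod \<beta> b \<in> carrier Q" using that closed by auto
      then show ?thesis
        using that by (simp add: h_diff h_of del: carrier_free_Abelian_group_iff)
          (simp add: a_minus_def Q.r_neg)
    qed
    show ?thesis
      using that unfolding tensor_relators_def
      by (elim UnE CollectE exE conjE)
        (auto intro!: triple double simp: add_l add_r bal smult N.ract_closed P.lact_closed)
  qed
  then have "tensor_relators k S N P \<subseteq> kernel ?F (add_monoid Q) h"
    using tensor_relators_subset [OF N.right_module_axioms P.left_module_axioms]
    by (simp add: kernel_def subset_iff del: carrier_free_Abelian_group_iff)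
  then have "tensor_kernel k S N P \<subseteq> kernel ?F (add_monoid Q) h"
    unfolding tensor_kernel_def by (intro h.G.generate_subgroup_incl h.subgroup_kernel)
  then obtain f where f: "f \<in> hom (?F Mod tensor_kernel k S N P) (add_monoid Q)"
    and f_cls: "\<And>u. u \<in> carrier ?F \<Longrightarrow> f (tensor_kernel k S N P #>\<^bsub>?F\<^esub> u) = h u"
    using h.FactGroup_universal_kernel [OF kernel_normal] by metis
  from f have "f \<in> hom (add_monoid T) (add_monoid Q)"
    by (simp add: hom_def tensor_def)
  then show thesis
    using f_cls h_of
    by (intro that [of "restrict f (carrier T)"]) (auto simp: hom_def tensor_class_def
        dest: pure_closed)
qed

end

section \<open>Induced maps between tensor products\<close>

text \<open>The data for which \<^const>\<open>tensor_map\<close> is well defined. The two algebras may differ, as they do for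
  the transition maps, where the algebra grows along the direct system; hence balancedness is
  required only of the composite with the tensor product in the target.\<close>

locale tensor_morphism =
  src: tensor_product k S N P + tgt: tensor_product k S' N' P'
  for k :: "('k, 'w) ring_scheme"
    and S :: "('k, 's, 'x) module_scheme"
    and N :: "('k, 'r, 's, 'n) bimod" and P :: "('k, 's, 't, 'p) bimod"
    and S' :: "('k, 's2, 'x2) module_scheme"
    and N' :: "('k, 'r2, 's2, 'n2) bimod" and P' :: "('k, 's2, 't2, 'p2) bimod" +
  fixes f :: "'n \<Rightarrow> 'n2" and h :: "'p \<Rightarrow> 'p2"
  assumes f_closed: "\<And>n. n \<in> carrier N \<Longrightarrow> f n \<in> carrier N'"
    and f_add: "\<And>n n'. \<lbrakk>n \<in> carrier N; n' \<in> carrier N\<rbrakk> \<Longrightarrow> f (n \<oplus>\<^bsub>N\<^esub> n') = f n \<oplus>\<^bsub>N'\<^esub> f n'"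
    and f_smult: "\<And>c n. \<lbrakk>c \<in> carrier k; n \<in> carrier N\<rbrakk> \<Longrightarrow> f (c \<odot>\<^bsub>N\<^esub> n) = c \<odot>\<^bsub>N'\<^esub> f n"
    and h_closed: "\<And>p. p \<in> carrier P \<Longrightarrow> h p \<in> carrier P'"
    and h_add: "\<And>p p'. \<lbrakk>p \<in> carrier P; p' \<in> carrier P\<rbrakk> \<Longrightarrow> h (p \<oplus>\<^bsub>P\<^esub> p') = h p \<oplus>\<^bsub>P'\<^esub> h p'"
    and h_smult: "\<And>c p. \<lbrakk>c \<in> carrier k; p \<in> carrier P\<rbrakk> \<Longrightarrow> h (c \<odot>\<^bsub>P\<^esub> p) = c \<odot>\<^bsub>P'\<^esub> h p"
    and map_balanced: "\<And>n s p. \<lbrakk>n \<in> carrier N; s \<in> carrier S; p \<in> carrier P\<rbrakk> \<Longrightarrow>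
      pure_tensor k S' N' P' (f (n \<triangleleft>\<^bsub>N\<^esub> s)) (h p) = pure_tensor k S' N' P' (f n) (h (s \<triangleright>\<^bsub>P\<^esub> p))"
begin

abbreviation "tmap \<equiv> tensor_map k S N P S' N' P' f h"

lemma map_class:
  assumes "u \<in> carrier (pair_group N P)"
  shows "tmap (src.cls u) = tgt.cls (frag_extend (\<lambda>(n, p). frag_of (f n, h p)) u)"
  by (rule tensor_map_class [OF src.N.right_module_axioms src.P.left_module_axioms
        tgt.N.right_module_axioms tgt.P.left_module_axioms
        _ f_add f_smult _ h_add h_smult map_balanced assms])
    (auto intro: f_closed h_closed)

lemma map_pure:
  assumes "n \<in> carrier N" "p \<in> carrier P"
  shows "tmap (src.pure n p) = tgt.pure (f n) (h p)"
  using assms by (subst map_class) auto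

lemma ext_closed:
  assumes "u \<in> carrier (pair_group N P)"
  shows "frag_extend (\<lambda>(n, p). frag_of (f n, h p)) u \<in> carrier (pair_group N' P')"
proof -
  have "Poly_Mapping.keys ((\<lambda>(n, p). frag_of (f n, h p)) z) \<subseteq> carrier N' \<times> carrier P'"
    if "z \<in> Poly_Mapping.keys u" for z
    using that assms by (cases z) (auto intro!: f_closed h_closed)
  then show ?thesis
    using keys_frag_extend [of "\<lambda>(n, p). frag_of (f n, h p)" u]
    by (simp only: carrier_free_Abelian_group_iff) blast
qed

lemma map_PiE: "tmap \<in> carrier src.T \<rightarrow>\<^sub>E carrier tgt.T"
proof (rule PiE_I)
  fix x assume "x \<in> carrier src.T"
  then show "tmap x \<in> carrier tgt.T"
    using ext_closed by (auto simp: src.carrier_tensor map_class intro!: tgt.cls_closed)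
next
  fix x assume "x \<notin> carrier src.T"
  then show "tmap x = undefined"
    by (simp add: tensor_map_def tensor_def)
qed

lemma map_closed: "x \<in> carrier src.T \<Longrightarrow> tmap x \<in> carrier tgt.T"
  using map_PiE by blast

lemma map_add:
  assumes "x \<in> carrier src.T" "y \<in> carrier src.T"
  shows "tmap (x \<oplus>\<^bsub>src.T\<^esub> y) = tmap x \<oplus>\<^bsub>tgt.T\<^esub> tmap y"
proof -
  obtain u v where u: "u \<in> carrier (pair_group N P)" "x = src.cls u"
    and v: "v \<in> carrier (pair_group N P)" "y = src.cls v"
    using assms by (auto simp: src.carrier_tensor)
  then have "u + v \<in> carrier (pair_group N P)"
    using keys_add [of u v] by auto
  then have "tmap (src.cls (u + v)) = tmap x \<oplus>\<^bsub>tgt.T\<^esub> tmap y"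
    using u v ext_closed by (simp add: map_class frag_extend_add tgt.cls_add
        del: carrier_free_Abelian_group_iff)
  then show ?thesis
    using u v by (simp add: src.cls_add)
qed

end

section \<open>The tensor product of bimodules\<close>

locale tensor_bimodules = N: bimodule k R S N + P: bimodule k S U P
  for k :: "('k, 'w) ring_scheme" and R :: "('k, 'r, 'x) module_scheme"
    and S :: "('k, 's, 'y) module_scheme" and U :: "('k, 't, 'z) module_scheme"
    and N :: "('k, 'r, 's, 'n) bimod" and P :: "('k, 's, 't, 'p) bimod"
begin

sublocale tensor_product k S N P ..

text \<open>The three actions on the tensor product are defined by \<^const>\<open>tensor_map\<close>, so their
  additivity and their values on pure tensors follow once the underlying pairs of maps are known to be
  compatible with the relations. On the left factor this needs the actions of \<open>R\<close> and \<open>k\<close> to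
  commute with that of \<open>S\<close>; on the right factor that of \<open>U\<close> has to.\<close>

lemma smult_morphism:
  assumes "c \<in> carrier k"
  shows "tensor_morphism k S N P S N P (\<lambda>n. c \<odot>\<^bsub>N\<^esub> n) (\<lambda>p. p)"
proof
  fix n s p assume "n \<in> carrier N" "s \<in> carrier S" "p \<in> carrier P"
  then show "pure (c \<odot>\<^bsub>N\<^esub> (n \<triangleleft>\<^bsub>N\<^esub> s)) p = pure (c \<odot>\<^bsub>N\<^esub> n) (s \<triangleright>\<^bsub>P\<^esub> p)"
    using assms by (simp flip: N.smult_ract pure_balanced)
next
  fix c' n assume "c' \<in> carrier k" "n \<in> carrier N"
  then show "c \<odot>\<^bsub>N\<^esub> (c' \<odot>\<^bsub>N\<^esub> n) = c' \<odot>\<^bsub>N\<^esub> (c \<odot>\<^bsub>N\<^esub> n)"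
    using assms by (simp flip: N.smult_assoc1 add: N.R.m_comm)
qed (use assms in \<open>auto simp: N.smult_r_distr\<close>)

lemma lact_morphism:
  assumes "r \<in> carrier R"
  shows "tensor_morphism k S N P S N P (\<lambda>n. r \<triangleright>\<^bsub>N\<^esub> n) (\<lambda>p. p)"
proof
  fix n s p assume "n \<in> carrier N" "s \<in> carrier S" "p \<in> carrier P"
  then show "pure (r \<triangleright>\<^bsub>N\<^esub> (n \<triangleleft>\<^bsub>N\<^esub> s)) p = pure (r \<triangleright>\<^bsub>N\<^esub> n) (s \<triangleright>\<^bsub>P\<^esub> p)"
    using assms by (simp flip: N.lact_ract pure_balanced add: N.lact_closed)
qed (use assms in \<open>auto simp: N.lact_closed N.lact_add_r N.lact_smult\<close>)

lemma ract_morphism: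
  assumes "t \<in> carrier U"
  shows "tensor_morphism k S N P S N P (\<lambda>n. n) (\<lambda>p. p \<triangleleft>\<^bsub>P\<^esub> t)"
proof
  fix n s p assume "n \<in> carrier N" "s \<in> carrier S" "p \<in> carrier P"
  then show "pure (n \<triangleleft>\<^bsub>N\<^esub> s) (p \<triangleleft>\<^bsub>P\<^esub> t) = pure n ((s \<triangleright>\<^bsub>P\<^esub> p) \<triangleleft>\<^bsub>P\<^esub> t)"
    using assms by (simp add: P.lact_ract pure_balanced P.ract_closed)
qed (use assms in \<open>auto simp: P.ract_closed P.ract_add_l P.smult_ract\<close>)

lemma smult_tensor: "c \<odot>\<^bsub>T\<^esub> x = tensor_map k S N P S N P (\<lambda>n. c \<odot>\<^bsub>N\<^esub> n) (\<lambda>p. p) x"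
  and lact_tensor: "r \<triangleright>\<^bsub>T\<^esub> x = tensor_map k S N P S N P (\<lambda>n. r \<triangleright>\<^bsub>N\<^esub> n) (\<lambda>p. p) x"
  and ract_tensor: "x \<triangleleft>\<^bsub>T\<^esub> t = tensor_map k S N P S N P (\<lambda>n. n) (\<lambda>p. p \<triangleleft>\<^bsub>P\<^esub> t) x"
  by (simp_all add: tensor_def)

context
  fixes c assumes c: "c \<in> carrier k"
begin

interpretation m: tensor_morphism k S N P S N P "\<lambda>n. c \<odot>\<^bsub>N\<^esub> n" "\<lambda>p. p"
  by (rule smult_morphism [OF c])

lemma smult_closed: "x \<in> carrier T \<Longrightarrow> c \<odot>\<^bsub>T\<^esub> x \<in> carrier T"
  using m.map_closed by (simp add: smult_tensor)

lemma smult_add: "\<lbrakk>x \<in> carrier T; y \<in> carrier T\<rbrakk> \<Longrightarrow>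
    c \<odot>\<^bsub>T\<^esub> (x \<oplus>\<^bsub>T\<^esub> y) = c \<odot>\<^bsub>T\<^esub> x \<oplus>\<^bsub>T\<^esub> c \<odot>\<^bsub>T\<^esub> y"
  using m.map_add by (simp add: smult_tensor)

lemma smult_pure: "\<lbrakk>n \<in> carrier N; p \<in> carrier P\<rbrakk> \<Longrightarrow> c \<odot>\<^bsub>T\<^esub> pure n p = pure (c \<odot>\<^bsub>N\<^esub> n) p"
  using m.map_pure by (simp add: smult_tensor)

end

context
  fixes r assumes r: "r \<in> carrier R"
begin

interpretation m: tensor_morphism k S N P S N P "\<lambda>n. r \<triangleright>\<^bsub>N\<^esub> n" "\<lambda>p. p"
  by (rule lact_morphism [OF r])

lemma lact_closed: "x \<in> carrier T \<Longrightarrow> r \<triangleright>\<^bsub>T\<^esub> x \<in> carrier T"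
  using m.map_closed by (simp add: lact_tensor)

lemma lact_add: "\<lbrakk>x \<in> carrier T; y \<in> carrier T\<rbrakk> \<Longrightarrow>
    r \<triangleright>\<^bsub>T\<^esub> (x \<oplus>\<^bsub>T\<^esub> y) = (r \<triangleright>\<^bsub>T\<^esub> x) \<oplus>\<^bsub>T\<^esub> (r \<triangleright>\<^bsub>T\<^esub> y)"
  using m.map_add by (simp add: lact_tensor)

lemma lact_pure: "\<lbrakk>n \<in> carrier N; p \<in> carrier P\<rbrakk> \<Longrightarrow> r \<triangleright>\<^bsub>T\<^esub> pure n p = pure (r \<triangleright>\<^bsub>N\<^esub> n) p"
  using m.map_pure by (simp add: lact_tensor)

end

context
  fixes t assumes t: "t \<in> carrier U"
begin

interpretation m: tensor_morphism k S N P S N P "\<lambda>n. n" "\<lambda>p. p \<triangleleft>\<^bsub>P\<^esub> t"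
  by (rule ract_morphism [OF t])

lemma ract_closed: "x \<in> carrier T \<Longrightarrow> x \<triangleleft>\<^bsub>T\<^esub> t \<in> carrier T"
  using m.map_closed by (simp add: ract_tensor)

lemma ract_add: "\<lbrakk>x \<in> carrier T; y \<in> carrier T\<rbrakk> \<Longrightarrow>
    (x \<oplus>\<^bsub>T\<^esub> y) \<triangleleft>\<^bsub>T\<^esub> t = x \<triangleleft>\<^bsub>T\<^esub> t \<oplus>\<^bsub>T\<^esub> y \<triangleleft>\<^bsub>T\<^esub> t"
  using m.map_add by (simp add: ract_tensor)

lemma ract_pure: "\<lbrakk>n \<in> carrier N; p \<in> carrier P\<rbrakk> \<Longrightarrow> pure n p \<triangleleft>\<^bsub>T\<^esub> t = pure n (p \<triangleleft>\<^bsub>P\<^esub> t)"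
  using m.map_pure by (simp add: ract_tensor)

end

lemmas action_closed = smult_closed lact_closed ract_closed
lemmas action_add = smult_add lact_add ract_add
lemmas action_pure = smult_pure lact_pure ract_pure

lemma module_tensor: "module k T"
proof (rule moduleI)
  fix a b x assume ab: "a \<in> carrier k" "b \<in> carrier k" and x: "x \<in> carrier T"
  show "(a \<oplus>\<^bsub>k\<^esub> b) \<odot>\<^bsub>T\<^esub> x = a \<odot>\<^bsub>T\<^esub> x \<oplus>\<^bsub>T\<^esub> b \<odot>\<^bsub>T\<^esub> x"
    using x
    by (induction rule: tensor_induct)
      (simp_all add: ab action_closed action_add action_pure N.smult_l_distr pure_add_left T.a_ac)
  show "(a \<otimes>\<^bsub>k\<^esub> b) \<odot>\<^bsub>T\<^esub> x = a \<odot>\<^bsub>T\<^esub> (b \<odot>\<^bsub>T\<^esub> x)"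
    using x
    by (induction rule: tensor_induct)
      (simp_all add: ab action_closed action_add action_pure N.smult_assoc1)
next
  fix x assume "x \<in> carrier T"
  then show "\<one>\<^bsub>k\<^esub> \<odot>\<^bsub>T\<^esub> x = x"
    by (induction rule: tensor_induct) (simp_all add: action_closed action_add action_pure)
qed (simp_all add: N.R.is_cring abelian_group_tensor action_closed action_add)

lemma bimodule_tensor: "bimodule k R U T"
proof -
  interpret T: module k T by (rule module_tensor)
  note simps = action_closed action_add action_pure T.a_ac pure_add_left pure_add_right
    N.lact_closed P.ract_closed
  show ?thesis
  proof unfold_locales
    fix r s x assume "r \<in> carrier R" "s \<in> carrier R" and x: "x \<in> carrier T"
    show "(r \<oplus>\<^bsub>R\<^esub> s) \<triangleright>\<^bsub>T\<^esub> x = (r \<triangleright>\<^bsub>T\<^esub> x) \<oplus>\<^bsub>T\<^esub> (s \<triangleright>\<^bsub>T\<^esub> x)"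
      using x
      by (induction rule: tensor_induct)
        (simp_all add: simps \<open>r \<in> carrier R\<close> \<open>s \<in> carrier R\<close> N.lact_add_l)
    show "(r \<otimes>\<^bsub>R\<^esub> s) \<triangleright>\<^bsub>T\<^esub> x = r \<triangleright>\<^bsub>T\<^esub> (s \<triangleright>\<^bsub>T\<^esub> x)"
      using x
      by (induction rule: tensor_induct)
        (simp_all add: simps \<open>r \<in> carrier R\<close> \<open>s \<in> carrier R\<close> N.lact_assoc N.R.mult_closed)
  next
    fix c r x assume "c \<in> carrier k" "r \<in> carrier R" and x: "x \<in> carrier T"
    show "r \<triangleright>\<^bsub>T\<^esub> (c \<odot>\<^bsub>T\<^esub> x) = c \<odot>\<^bsub>T\<^esub> (r \<triangleright>\<^bsub>T\<^esub> x)"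
      using x
      by (induction rule: tensor_induct)
        (simp_all add: simps \<open>c \<in> carrier k\<close> \<open>r \<in> carrier R\<close> N.lact_smult)
    show "(c \<odot>\<^bsub>R\<^esub> r) \<triangleright>\<^bsub>T\<^esub> x = c \<odot>\<^bsub>T\<^esub> (r \<triangleright>\<^bsub>T\<^esub> x)"
      using x
      by (induction rule: tensor_induct)
        (simp_all add: simps \<open>c \<in> carrier k\<close> \<open>r \<in> carrier R\<close> N.smult_lact)
  next
    fix x s t assume "s \<in> carrier U" "t \<in> carrier U" and x: "x \<in> carrier T"
    show "x \<triangleleft>\<^bsub>T\<^esub> (s \<oplus>\<^bsub>U\<^esub> t) = x \<triangleleft>\<^bsub>T\<^esub> s \<oplus>\<^bsub>T\<^esub> x \<triangleleft>\<^bsub>T\<^esub> t"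
      using x
      by (induction rule: tensor_induct)
        (simp_all add: simps \<open>s \<in> carrier U\<close> \<open>t \<in> carrier U\<close> P.ract_add_r)
    show "x \<triangleleft>\<^bsub>T\<^esub> (s \<otimes>\<^bsub>U\<^esub> t) = (x \<triangleleft>\<^bsub>T\<^esub> s) \<triangleleft>\<^bsub>T\<^esub> t"
      using x
      by (induction rule: tensor_induct)
        (simp_all add: simps \<open>s \<in> carrier U\<close> \<open>t \<in> carrier U\<close> P.ract_assoc P.S.mult_closed)
  next
    fix c x t assume "c \<in> carrier k" "t \<in> carrier U" and x: "x \<in> carrier T"
    show "(c \<odot>\<^bsub>T\<^esub> x) \<triangleleft>\<^bsub>T\<^esub> t = c \<odot>\<^bsub>T\<^esub> (x \<triangleleft>\<^bsub>T\<^esub> t)"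
      using x
      by (induction rule: tensor_induct)
        (simp_all add: simps \<open>c \<in> carrier k\<close> \<open>t \<in> carrier U\<close>)
    \<comment> \<open>A scalar acts on the left factor of a pure tensor, so it has to be moved there.\<close>
    show "x \<triangleleft>\<^bsub>T\<^esub> (c \<odot>\<^bsub>U\<^esub> t) = c \<odot>\<^bsub>T\<^esub> (x \<triangleleft>\<^bsub>T\<^esub> t)"
      using x
      by (induction rule: tensor_induct)
        (simp_all add: simps \<open>c \<in> carrier k\<close> \<open>t \<in> carrier U\<close> P.ract_smult pure_smult)
  next
    fix r x t assume "r \<in> carrier R" "t \<in> carrier U" and x: "x \<in> carrier T"
    show "(r \<triangleright>\<^bsub>T\<^esub> x) \<triangleleft>\<^bsub>T\<^esub> t = r \<triangleright>\<^bsub>T\<^esub> (x \<triangleleft>\<^bsub>T\<^esub> t)"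
      using x
      by (induction rule: tensor_induct)
        (simp_all add: simps \<open>r \<in> carrier R\<close> \<open>t \<in> carrier U\<close>)
  qed (simp_all add: action_closed action_add)
qed

lemma left_unital_tensor:
  assumes "left_unital R N" "\<one>\<^bsub>R\<^esub> \<in> carrier R" shows "left_unital R T"
  unfolding left_unital_def
proof
  fix x assume "x \<in> carrier T"
  then show "\<one>\<^bsub>R\<^esub> \<triangleright>\<^bsub>T\<^esub> x = x"
    by (induction rule: tensor_induct)
      (use assms in \<open>simp_all add: left_unital_def action_pure action_add\<close>)
qed

lemma right_unital_tensor:
  assumes "right_unital U P" "\<one>\<^bsub>U\<^esub> \<in> carrier U" shows "right_unital U T"
  unfolding right_unital_def
proof
  fix x assume "x \<in> carrier T"
  then show "x \<triangleleft>\<^bsub>T\<^esub> \<one>\<^bsub>U\<^esub> = x"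
    by (induction rule: tensor_induct)
      (use assms in \<open>simp_all add: right_unital_def action_pure action_add\<close>)
qed

end

section \<open>Bimodule morphisms\<close>

lemma bimod_homD:
  assumes "f \<in> bimod_hom k R S M N"
  shows "f \<in> carrier M \<rightarrow>\<^sub>E carrier N"
    and "x \<in> carrier M \<Longrightarrow> f x \<in> carrier N"
    and "\<lbrakk>x \<in> carrier M; y \<in> carrier M\<rbrakk> \<Longrightarrow> f (x \<oplus>\<^bsub>M\<^esub> y) = f x \<oplus>\<^bsub>N\<^esub> f y"
    and "\<lbrakk>c \<in> carrier k; x \<in> carrier M\<rbrakk> \<Longrightarrow> f (c \<odot>\<^bsub>M\<^esub> x) = c \<odot>\<^bsub>N\<^esub> f x"
    and "\<lbrakk>r \<in> carrier R; x \<in> carrier M\<rbrakk> \<Longrightarrow> f (r \<triangleright>\<^bsub>M\<^esub> x) = r \<triangleright>\<^bsub>N\<^esub> f x"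
    and "\<lbrakk>s \<in> carrier S; x \<in> carrier M\<rbrakk> \<Longrightarrow> f (x \<triangleleft>\<^bsub>M\<^esub> s) = f x \<triangleleft>\<^bsub>N\<^esub> s"
  using assms by (auto simp: bimod_hom_def)

lemma bimod_homI:
  assumes "f \<in> carrier M \<rightarrow>\<^sub>E carrier N"
    and "\<And>x y. \<lbrakk>x \<in> carrier M; y \<in> carrier M\<rbrakk> \<Longrightarrow> f (x \<oplus>\<^bsub>M\<^esub> y) = f x \<oplus>\<^bsub>N\<^esub> f y"
    and "\<And>c x. \<lbrakk>c \<in> carrier k; x \<in> carrier M\<rbrakk> \<Longrightarrow> f (c \<odot>\<^bsub>M\<^esub> x) = c \<odot>\<^bsub>N\<^esub> f x"
    and "\<And>r x. \<lbrakk>r \<in> carrier R; x \<in> carrier M\<rbrakk> \<Longrightarrow> f (r \<triangleright>\<^bsub>M\<^esub> x) = r \<triangleright>\<^bsub>N\<^esub> f x"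
    and "\<And>s x. \<lbrakk>s \<in> carrier S; x \<in> carrier M\<rbrakk> \<Longrightarrow> f (x \<triangleleft>\<^bsub>M\<^esub> s) = f x \<triangleleft>\<^bsub>N\<^esub> s"
  shows "f \<in> bimod_hom k R S M N"
  using assms by (auto simp: bimod_hom_def)

lemma compose_bimod_hom:
  assumes M: "bimodule k R S M"
    and f: "f \<in> bimod_hom k R S M N" and g: "g \<in> bimod_hom k R S N Q"
  shows "compose (carrier M) g f \<in> bimod_hom k R S M Q"
proof -
  interpret M: bimodule k R S M by fact
  show ?thesis
    by (rule bimod_homI)
      (simp_all add: compose_def bimod_homD [OF f] bimod_homD [OF g] M.lact_closed M.ract_closed)
qed

lemma id_bimod_hom:
  assumes "bimodule k R S M"
  shows "(\<lambda>x\<in>carrier M. x) \<in> bimod_hom k R S M M"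
proof -
  interpret M: bimodule k R S M by fact
  show ?thesis
    by (rule bimod_homI) (simp_all add: M.lact_closed M.ract_closed)
qed

lemma (in tensor_product) bimod_hom_eqI:
  assumes f: "f \<in> bimod_hom k R' U' T Q" and g: "g \<in> bimod_hom k R' U' T Q"
    and eq: "\<And>n p. \<lbrakk>n \<in> carrier N; p \<in> carrier P\<rbrakk> \<Longrightarrow> f (pure n p) = g (pure n p)"
  shows "f = g"
proof (rule PiE_ext)
  show "f \<in> carrier T \<rightarrow>\<^sub>E carrier Q" "g \<in> carrier T \<rightarrow>\<^sub>E carrier Q"
    using f g bimod_homD(1) by blast+
  fix x assume "x \<in> carrier T"
  then show "f x = g x"
    by (rule additive_eqI [of f Q g, rotated -1])
      (simp_all add: bimod_homD(3) [OF f] bimod_homD(3) [OF g] eq)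
qed

locale tensor_bimodule_morphism =
  src: tensor_bimodules k R S U N P + tgt: tensor_bimodules k R S' U N' P' +
  tensor_morphism k S N P S' N' P' f h
  for k :: "('k, 'w) ring_scheme" and R :: "('k, 'r) module"
    and S :: "('k, 's) module" and U :: "('k, 't) module"
    and N :: "('k, 'r, 's, 'n) bimod" and P :: "('k, 's, 't, 'p) bimod"
    and S' :: "('k, 's2) module"
    and N' :: "('k, 'r, 's2, 'n2) bimod" and P' :: "('k, 's2, 't, 'p2) bimod"
    and f :: "'n \<Rightarrow> 'n2" and h :: "'p \<Rightarrow> 'p2" +
  assumes f_lact: "\<And>r n. \<lbrakk>r \<in> carrier R; n \<in> carrier N\<rbrakk> \<Longrightarrow> f (r \<triangleright>\<^bsub>N\<^esub> n) = r \<triangleright>\<^bsub>N'\<^esub> f n"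
    and h_ract: "\<And>p t. \<lbrakk>p \<in> carrier P; t \<in> carrier U\<rbrakk> \<Longrightarrow> h (p \<triangleleft>\<^bsub>P\<^esub> t) = h p \<triangleleft>\<^bsub>P'\<^esub> t"
begin

lemmas morphism_simps = src.action_closed src.action_add src.action_pure tgt.action_closed
  tgt.action_add tgt.action_pure map_add map_closed map_pure f_closed h_closed
  src.N.lact_closed src.P.ract_closed

lemma map_bimod_hom: "tmap \<in> bimod_hom k R U src.T tgt.T"
proof (rule bimod_homI)
  fix c x assume c: "c \<in> carrier k" and x: "x \<in> carrier src.T"
  from x show "tmap (c \<odot>\<^bsub>src.T\<^esub> x) = c \<odot>\<^bsub>tgt.T\<^esub> tmap x"
    by (induction x rule: src.tensor_induct) (simp_all add: morphism_simps c f_smult)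
next
  fix r x assume r: "r \<in> carrier R" and x: "x \<in> carrier src.T"
  from x show "tmap (r \<triangleright>\<^bsub>src.T\<^esub> x) = r \<triangleright>\<^bsub>tgt.T\<^esub> tmap x"
    by (induction x rule: src.tensor_induct) (simp_all add: morphism_simps r f_lact)
next
  fix t x assume t: "t \<in> carrier U" and x: "x \<in> carrier src.T"
  from x show "tmap (x \<triangleleft>\<^bsub>src.T\<^esub> t) = tmap x \<triangleleft>\<^bsub>tgt.T\<^esub> t"
    by (induction x rule: src.tensor_induct) (simp_all add: morphism_simps t h_ract)
qed (simp_all add: map_PiE map_add)

end

section \<open>Restriction to subalgebras and subbimodules\<close>

text \<open>Closure under negatives comes for free, as \<open>- x = (- 1) x\<close>.\<close>

lemma (in module) module_carrier_update:
  assumes "H \<subseteq> carrier M" "\<zero>\<^bsub>M\<^esub> \<in> H"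
    and add: "\<And>x y. \<lbrakk>x \<in> H; y \<in> H\<rbrakk> \<Longrightarrow> x \<oplus>\<^bsub>M\<^esub> y \<in> H"
    and smult: "\<And>c x. \<lbrakk>c \<in> carrier R; x \<in> H\<rbrakk> \<Longrightarrow> c \<odot>\<^bsub>M\<^esub> x \<in> H"
  shows "module R (M\<lparr>carrier := H\<rparr>)"
proof (rule submodule.submodule_is_module [OF submoduleI])
  fix x assume x: "x \<in> H"
  have "(\<ominus>\<^bsub>R\<^esub> \<one>\<^bsub>R\<^esub>) \<odot>\<^bsub>M\<^esub> x = \<ominus>\<^bsub>M\<^esub> x"
    using x assms(1) smult_l_minus [of "\<one>\<^bsub>R\<^esub>" x] by (simp add: subset_iff)
  then show "\<ominus>\<^bsub>M\<^esub> x \<in> H"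
    using smult [OF _ x, of "\<ominus>\<^bsub>R\<^esub> \<one>\<^bsub>R\<^esub>"] by simp
qed (use assms module_axioms in auto)

text \<open>Both kinds of subbimodules that occur below are instances: \<open>e\<^sub>i P\<close>, where the algebra shrinks from
  \<open>B\<close> to \<open>e\<^sub>i B e\<^sub>i\<close>, and \<open>P\<^sup>\<dagger>\<close> inside \<open>P\<^sup>*\<close>, where it stays the same. The units of the two algebras
  may differ, as those of \<open>B\<close> and of a corner do.\<close>

lemma bimodule_restrict:
  fixes R R' :: "('k, 'r) module" and S :: "('k, 's) module" and M :: "('k, 'r, 's, 'm) bimod"
  assumes M: "bimodule k R S M" and R': "nonunital_algebra k R'"
    and sub: "carrier R' \<subseteq> carrier R"
    and ops: "ring.add R' = ring.add R" "monoid.mult R' = monoid.mult R" "smult R' = smult R"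
    and H: "H \<subseteq> carrier M" "\<zero>\<^bsub>M\<^esub> \<in> H"
    and add: "\<And>x y. \<lbrakk>x \<in> H; y \<in> H\<rbrakk> \<Longrightarrow> x \<oplus>\<^bsub>M\<^esub> y \<in> H"
    and smult: "\<And>c x. \<lbrakk>c \<in> carrier k; x \<in> H\<rbrakk> \<Longrightarrow> c \<odot>\<^bsub>M\<^esub> x \<in> H"
    and lact: "\<And>r x. \<lbrakk>r \<in> carrier R'; x \<in> H\<rbrakk> \<Longrightarrow> r \<triangleright>\<^bsub>M\<^esub> x \<in> H"
    and ract: "\<And>x s. \<lbrakk>x \<in> H; s \<in> carrier S\<rbrakk> \<Longrightarrow> x \<triangleleft>\<^bsub>M\<^esub> s \<in> H"
  shows "bimodule k R' S (M\<lparr>carrier := H\<rparr>)"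
proof -
  interpret M: bimodule k R S M by fact
  interpret R': nonunital_algebra k R' by fact
  interpret H: module k "M\<lparr>carrier := H\<rparr>"
    using H add smult by (rule M.module_carrier_update)
  have [simp]: "x \<in> carrier M" if "x \<in> H" for x using that H by blast
  have [simp]: "r \<in> carrier R" if "r \<in> carrier R'" for r using that sub by blast
  show ?thesis
    by unfold_locales
      (simp_all add: lact ract ops M.lact_add_r M.lact_add_l M.lact_assoc M.lact_smult M.smult_lact
        M.ract_add_l M.ract_add_r M.ract_assoc M.smult_ract M.ract_smult M.lact_ract)
qed

context nonunital_algebra
begin

lemma mult_zero_left: "x \<in> carrier B \<Longrightarrow> \<zero>\<^bsub>B\<^esub> \<otimes>\<^bsub>B\<^esub> x = \<zero>\<^bsub>B\<^esub>"
  using smult_mult_l [of "\<zero>\<^bsub>k\<^esub>" "\<zero>\<^bsub>B\<^esub>" x] by (simp add: mult_closed)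

lemma mult_zero_right: "x \<in> carrier B \<Longrightarrow> x \<otimes>\<^bsub>B\<^esub> \<zero>\<^bsub>B\<^esub> = \<zero>\<^bsub>B\<^esub>"
  using smult_mult_r [of "\<zero>\<^bsub>k\<^esub>" x "\<zero>\<^bsub>B\<^esub>"] by (simp add: mult_closed)

end

lemma (in left_module) lact_zero: "r \<in> carrier R \<Longrightarrow> r \<triangleright>\<^bsub>M\<^esub> \<zero>\<^bsub>M\<^esub> = \<zero>\<^bsub>M\<^esub>"
  using lact_smult [of "\<zero>\<^bsub>k\<^esub>" r "\<zero>\<^bsub>M\<^esub>"] by (simp add: lact_closed)

lemma regular_right_module:
  fixes B :: "('k, 'b) module"
  assumes "nonunital_algebra k B" shows "right_module k B (regular B)"
proof -
  interpret B: nonunital_algebra k B by fact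
  interpret R: module k "regular B"
  proof (rule moduleI)
    show "abelian_group (regular B)"
      by (rule abelian_groupI)
        (use B.M.add.l_inv_ex in \<open>auto simp: regular_def B.M.a_ac\<close>)
  qed (simp_all add: regular_def B.R.is_cring B.smult_l_distr B.smult_r_distr B.smult_assoc1)
  show ?thesis
    by unfold_locales (simp_all add: regular_def B.mult_closed B.mult_assoc B.mult_l_distr
        B.mult_r_distr B.smult_mult_l B.smult_mult_r)
qed

section \<open>Dual bimodules\<close>

locale dual_of_bimodule = A: unital_algebra k A + P: bimodule k B A P
  for k :: "('k, 'w) ring_scheme" and A :: "('k, 'a) module" and B :: "('k, 'b) module"
    and P :: "('k, 'b, 'a, 'p) bimod" +
  assumes right_unital: "right_unital A P"
begin

abbreviation "D \<equiv> dual A P"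

lemma dual_iff:
  "\<phi> \<in> carrier D \<longleftrightarrow> \<phi> \<in> carrier P \<rightarrow>\<^sub>E carrier A \<and>
    (\<forall>p\<in>carrier P. \<forall>q\<in>carrier P. \<phi> (p \<oplus>\<^bsub>P\<^esub> q) = \<phi> p \<oplus>\<^bsub>A\<^esub> \<phi> q) \<and>
    (\<forall>p\<in>carrier P. \<forall>a\<in>carrier A. \<phi> (p \<triangleleft>\<^bsub>P\<^esub> a) = \<phi> p \<otimes>\<^bsub>A\<^esub> a)"
  by (simp add: dual_def right_hom_def regular_def)

lemma dualD:
  assumes "\<phi> \<in> carrier D" "p \<in> carrier P"
  shows "\<phi> p \<in> carrier A"
    and "q \<in> carrier P \<Longrightarrow> \<phi> (p \<oplus>\<^bsub>P\<^esub> q) = \<phi> p \<oplus>\<^bsub>A\<^esub> \<phi> q"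
    and "a \<in> carrier A \<Longrightarrow> \<phi> (p \<triangleleft>\<^bsub>P\<^esub> a) = \<phi> p \<otimes>\<^bsub>A\<^esub> a"
  using assms by (auto simp: dual_iff)

text \<open>Since \<open>A\<close> has a unit that acts as the identity, a scalar \<open>c\<close> acts on \<open>P\<close> like the element
  \<open>c 1\<close> of \<open>A\<close>, so \<open>A\<close>-linear functionals are \<open>k\<close>-linear. The dual needs this to be a bimodule
  over \<open>k\<close>: the scalars reach the functional through \<open>B\<close>, by \<open>(\<phi> (c b)) (p) = \<phi> (c (b p))\<close>.\<close>

lemma dual_smult:
  assumes \<phi>: "\<phi> \<in> carrier D" and c: "c \<in> carrier k" and p: "p \<in> carrier P"
  shows "\<phi> (c \<odot>\<^bsub>P\<^esub> p) = c \<odot>\<^bsub>A\<^esub> \<phi> p"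
proof -
  have "c \<odot>\<^bsub>P\<^esub> p = p \<triangleleft>\<^bsub>P\<^esub> (c \<odot>\<^bsub>A\<^esub> \<one>\<^bsub>A\<^esub>)"
    using c p right_unital by (simp add: P.ract_smult right_unital_def)
  then show ?thesis
    using \<phi> c p by (simp add: dualD A.smult_mult_r)
qed

lemma dual_eqI:
  "\<lbrakk>\<phi> \<in> carrier D; \<psi> \<in> carrier D; \<And>p. p \<in> carrier P \<Longrightarrow> \<phi> p = \<psi> p\<rbrakk> \<Longrightarrow> \<phi> = \<psi>"
  by (rule PiE_ext [of _ "carrier P" "\<lambda>_. carrier A"]) (auto simp: dual_iff)

lemma dual_apply:
  assumes "p \<in> carrier P"
  shows "\<zero>\<^bsub>D\<^esub> p = \<zero>\<^bsub>A\<^esub>"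
    and "(\<phi> \<oplus>\<^bsub>D\<^esub> \<psi>) p = \<phi> p \<oplus>\<^bsub>A\<^esub> \<psi> p"
    and "(c \<odot>\<^bsub>D\<^esub> \<phi>) p = c \<odot>\<^bsub>A\<^esub> \<phi> p"
    and "(\<phi> \<triangleleft>\<^bsub>D\<^esub> b) p = \<phi> (b \<triangleright>\<^bsub>P\<^esub> p)"
    and "(a \<triangleright>\<^bsub>D\<^esub> \<phi>) p = a \<otimes>\<^bsub>A\<^esub> \<phi> p"
  using assms by (simp_all add: dual_def)

lemma zero_dual_closed: "\<zero>\<^bsub>D\<^esub> \<in> carrier D"
  unfolding dual_iff by (auto simp: dual_apply P.ract_closed) (simp add: dual_def)

lemma add_dual_closed: "\<lbrakk>\<phi> \<in> carrier D; \<psi> \<in> carrier D\<rbrakk> \<Longrightarrow> \<phi> \<oplus>\<^bsub>D\<^esub> \<psi> \<in> carrier D"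
  unfolding dual_iff [of "\<phi> \<oplus>\<^bsub>D\<^esub> \<psi>"]
  by (auto simp: dual_apply P.ract_closed dualD A.l_distr A.a_ac) (simp add: dual_def)

lemma smult_dual_closed: "\<lbrakk>c \<in> carrier k; \<phi> \<in> carrier D\<rbrakk> \<Longrightarrow> c \<odot>\<^bsub>D\<^esub> \<phi> \<in> carrier D"
  unfolding dual_iff [of "c \<odot>\<^bsub>D\<^esub> \<phi>"]
  by (auto simp: dual_apply P.ract_closed dualD A.smult_r_distr A.smult_mult_l) (simp add: dual_def)

lemma ract_dual_closed: "\<lbrakk>\<phi> \<in> carrier D; b \<in> carrier B\<rbrakk> \<Longrightarrow> \<phi> \<triangleleft>\<^bsub>D\<^esub> b \<in> carrier D"
  unfolding dual_iff [of "\<phi> \<triangleleft>\<^bsub>D\<^esub> b"]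
  by (auto simp: dual_apply P.ract_closed P.lact_closed dualD P.lact_add_r simp flip: P.lact_ract)
    (simp add: dual_def)

lemma lact_dual_closed: "\<lbrakk>a \<in> carrier A; \<phi> \<in> carrier D\<rbrakk> \<Longrightarrow> a \<triangleright>\<^bsub>D\<^esub> \<phi> \<in> carrier D"
  unfolding dual_iff [of "a \<triangleright>\<^bsub>D\<^esub> \<phi>"]
  by (auto simp: dual_apply P.ract_closed dualD A.r_distr A.m_assoc) (simp add: dual_def)

lemmas dual_closed = zero_dual_closed add_dual_closed smult_dual_closed ract_dual_closed
  lact_dual_closed

lemma bimodule_dual: "bimodule k A B D"
proof -
  interpret D: module k D
  proof (rule moduleI)
    show "abelian_group D"
    proof (rule abelian_groupI)
      fix \<phi> assume \<phi>: "\<phi> \<in> carrier D"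
      \<comment> \<open>The multiple by \<open>- 1\<close> serves as the negative, since scalar multiples are known to be functionals.\<close>
      have "(\<ominus>\<^bsub>k\<^esub> \<one>\<^bsub>k\<^esub>) \<odot>\<^bsub>D\<^esub> \<phi> \<oplus>\<^bsub>D\<^esub> \<phi> = \<zero>\<^bsub>D\<^esub>"
        using \<phi> by (intro dual_eqI)
          (simp_all add: dual_closed dual_apply dualD A.smult_l_minus A.l_neg)
      then show "\<exists>\<psi>\<in>carrier D. \<psi> \<oplus>\<^bsub>D\<^esub> \<phi> = \<zero>\<^bsub>D\<^esub>"
        using \<phi> by (intro bexI [of _ "(\<ominus>\<^bsub>k\<^esub> \<one>\<^bsub>k\<^esub>) \<odot>\<^bsub>D\<^esub> \<phi>"]) (simp_all add: dual_closed)
    qed (auto intro!: dual_eqI simp: dual_closed dual_apply dualD A.a_ac)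
  qed (auto intro!: dual_eqI simp: dual_closed dual_apply dualD A.smult_l_distr
      A.smult_r_distr A.smult_assoc1 A.R.is_cring)
  show ?thesis
    by unfold_locales
      (auto intro!: dual_eqI simp: dual_closed dual_apply dualD dual_smult A.smult_l_distr
        A.smult_r_distr A.l_distr A.r_distr A.m_assoc A.smult_mult_l A.smult_mult_r
        P.lact_closed P.lact_add_l P.lact_assoc P.smult_lact P.R.mult_closed)
qed

lemma left_unital_dual: "left_unital A D"
  unfolding left_unital_def
  by (auto intro!: dual_eqI simp: dual_closed dual_apply dualD)

end

section \<open>Firm bimodules over an algebra with idempotent local units\<close>

locale firm_bimodule_local_units = dual_of_bimodule k A B P
  for k :: "'k ring" and A :: "('k, 'a) module" and B :: "('k, 'b) module"
    and P :: "('k, 'b, 'a, 'p) bimod" +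
  fixes I :: "'i set" and e :: "'i \<Rightarrow> 'b"
  assumes local_units: "idempotent_local_units B I e"
    and firm: "left_firm k B P"
begin

abbreviation "B_at \<equiv> corner B e"
abbreviation "P_at \<equiv> component P e"
abbreviation "D_at i \<equiv> dual A (component P e i)"
abbreviation "G \<equiv> G_obj k A B P e"
abbreviation "Pd \<equiv> dagger A P I e"
abbreviation "L \<equiv> tensor k B (dagger A P I e) P"
abbreviation "pure_at i \<equiv> pure_tensor k (corner B e i) (dual A (component P e i)) (component P e i)"
abbreviation "pure_L \<equiv> pure_tensor k B (dagger A P I e) P"
abbreviation "G_tr \<equiv> G_map k A B P e"
abbreviation "g \<equiv> g_map k A B P I e"

lemma e_closed: "i \<in> I \<Longrightarrow> e i \<in> carrier B"
  and e_idem: "i \<in> I \<Longrightarrow> e i \<otimes>\<^bsub>B\<^esub> e i = e i"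
  using local_units by (auto simp: idempotent_local_units_def)

lemma e_lact_closed: "\<lbrakk>i \<in> I; p \<in> carrier P\<rbrakk> \<Longrightarrow> e i \<triangleright>\<^bsub>P\<^esub> p \<in> carrier P"
  by (simp add: e_closed P.lact_closed)

lemma e_lact_idem: "\<lbrakk>i \<in> I; p \<in> carrier P\<rbrakk> \<Longrightarrow> e i \<triangleright>\<^bsub>P\<^esub> (e i \<triangleright>\<^bsub>P\<^esub> p) = e i \<triangleright>\<^bsub>P\<^esub> p"
  by (simp add: e_closed e_idem flip: P.lact_assoc)

lemma carrier_B_at:
  assumes i: "i \<in> I"
  shows "carrier (B_at i) = {b \<in> carrier B. e i \<otimes>\<^bsub>B\<^esub> b = b \<and> b \<otimes>\<^bsub>B\<^esub> e i = b}"
proof (intro subset_antisym subsetI)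
  fix x assume "x \<in> carrier (B_at i)"
  then obtain b where b: "b \<in> carrier B" "x = e i \<otimes>\<^bsub>B\<^esub> b \<otimes>\<^bsub>B\<^esub> e i"
    by (auto simp: corner_def)
  have "e i \<otimes>\<^bsub>B\<^esub> x = (e i \<otimes>\<^bsub>B\<^esub> e i) \<otimes>\<^bsub>B\<^esub> b \<otimes>\<^bsub>B\<^esub> e i"
    using b e_closed [OF i] by (simp add: P.R.mult_closed P.R.mult_assoc)
  moreover have "x \<otimes>\<^bsub>B\<^esub> e i = e i \<otimes>\<^bsub>B\<^esub> b \<otimes>\<^bsub>B\<^esub> (e i \<otimes>\<^bsub>B\<^esub> e i)"
    using b e_closed [OF i] by (simp add: P.R.mult_closed P.R.mult_assoc)
  ultimately show "x \<in> {b \<in> carrier B. e i \<otimes>\<^bsub>B\<^esub> b = b \<and> b \<otimes>\<^bsub>B\<^esub> e i = b}"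
    using b e_closed [OF i] by (simp add: e_idem [OF i] P.R.mult_closed)
next
  fix x assume "x \<in> {b \<in> carrier B. e i \<otimes>\<^bsub>B\<^esub> b = b \<and> b \<otimes>\<^bsub>B\<^esub> e i = b}"
  then show "x \<in> carrier (B_at i)"
    by (auto simp: corner_def intro!: image_eqI [of _ _ x])
qed

lemma carrier_P_at:
  assumes i: "i \<in> I"
  shows "carrier (P_at i) = {p \<in> carrier P. e i \<triangleright>\<^bsub>P\<^esub> p = p}"
  by (force simp: component_def e_lact_closed [OF i] e_lact_idem [OF i])

text \<open>The condition \<open>\<phi> = \<phi> \<circ> \<sigma>\<^sub>i \<circ> \<tau>\<^sub>i\<close> says that \<open>\<phi>\<close> is fixed by \<open>e\<^sub>i\<close>. In this form membership in
  \<open>P\<^sup>\<dagger>\<close> is a statement about local units, on a par with \<open>e\<^sub>i p = p\<close>.\<close>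

lemma carrier_Pd:
  "carrier Pd = {\<phi> \<in> carrier D. \<exists>i\<in>I. \<forall>p\<in>carrier P. \<phi> (e i \<triangleright>\<^bsub>P\<^esub> p) = \<phi> p}"
proof -
  have "\<phi> = compose (carrier P) (compose (carrier (P_at i)) \<phi> (incl P e i)) (proj P e i) \<longleftrightarrow>
      (\<forall>p\<in>carrier P. \<phi> (e i \<triangleright>\<^bsub>P\<^esub> p) = \<phi> p)"
    (is "\<phi> = ?\<psi> \<longleftrightarrow> _") if \<phi>: "\<phi> \<in> carrier D" and i: "i \<in> I" for \<phi> i
  proof -
    have \<psi>: "?\<psi> = (\<lambda>p\<in>carrier P. \<phi> (e i \<triangleright>\<^bsub>P\<^esub> p))"
      by (auto simp: compose_def incl_def proj_def carrier_P_at [OF i]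
          e_lact_closed [OF i] e_lact_idem [OF i] fun_eq_iff restrict_def)
    have "\<phi> \<in> extensional (carrier P)"
      using \<phi> by (auto simp: dual_iff PiE_def)
    then show ?thesis
      unfolding \<psi> by (auto simp: fun_eq_iff restrict_def extensional_def)
  qed
  then show ?thesis
    by (auto simp: dagger_def)
qed

subsection \<open>Common local units\<close>

text \<open>This is where firmness enters. The canonical map \<open>B \<otimes>\<^sub>B P \<rightarrow> P\<close> is surjective, so an element of
  \<open>P\<close> is a finite sum of elements \<open>b p\<close>, and any \<open>e\<^sub>i\<close> that fixes all the coefficients \<open>b\<close> from the
  left fixes the sum.\<close>

lemma unit_for_element:
  assumes p: "p \<in> carrier P" obtains i where "i \<in> I" "e i \<triangleright>\<^bsub>P\<^esub> p = p"
proof -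
  interpret R: right_module k B "regular B"
    by (rule regular_right_module [OF P.R.nonunital_algebra_axioms])
  interpret R: tensor_product k B "regular B" P ..
  obtain f where f: "f \<in> iso (add_monoid R.T) (add_monoid P)"
    and f_pure: "\<And>b p. \<lbrakk>b \<in> carrier B; p \<in> carrier P\<rbrakk> \<Longrightarrow> f (R.pure b p) = b \<triangleright>\<^bsub>P\<^esub> p"
    using firm by (auto simp: left_firm_def)
  have f_add: "f (x \<oplus>\<^bsub>R.T\<^esub> y) = f x \<oplus>\<^bsub>P\<^esub> f y" if "x \<in> carrier R.T" "y \<in> carrier R.T" for x y
    using f that by (auto simp: iso_def hom_def)
  have f_closed: "f x \<in> carrier P" if "x \<in> carrier R.T" for x
    using f that by (auto simp: iso_def hom_def)
  \<comment> \<open>A set of coefficients, rather than a unit, is collected because it survives taking sums.\<close>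
  have ex: "\<exists>F. finite F \<and> F \<subseteq> carrier B \<and>
      (\<forall>i\<in>I. (\<forall>b\<in>F. e i \<otimes>\<^bsub>B\<^esub> b = b) \<longrightarrow> e i \<triangleright>\<^bsub>P\<^esub> f x = f x)" if "x \<in> carrier R.T" for x
    using that
  proof (induction x rule: R.tensor_induct)
    case (pure b p)
    then have b: "b \<in> carrier B" by (simp add: regular_def)
    with pure show ?case
      by (intro exI [of _ "{b}"]) (auto simp: f_pure e_closed simp flip: P.lact_assoc)
  next
    case (add x y)
    then obtain F F' where "finite F" "F \<subseteq> carrier B" "finite F'" "F' \<subseteq> carrier B"
      "\<forall>i\<in>I. (\<forall>b\<in>F. e i \<otimes>\<^bsub>B\<^esub> b = b) \<longrightarrow> e i \<triangleright>\<^bsub>P\<^esub> f x = f x"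
      "\<forall>i\<in>I. (\<forall>b\<in>F'. e i \<otimes>\<^bsub>B\<^esub> b = b) \<longrightarrow> e i \<triangleright>\<^bsub>P\<^esub> f y = f y"
      by blast
    then show ?case
      using add
      by (intro exI [of _ "F \<union> F'"]) (auto simp: f_add f_closed e_closed P.lact_add_r)
  qed
  obtain x where x: "x \<in> carrier R.T" "p = f x"
    using f p by (auto simp: iso_def bij_betw_def)
  obtain F where F: "finite F" "F \<subseteq> carrier B"
    "\<forall>i\<in>I. (\<forall>b\<in>F. e i \<otimes>\<^bsub>B\<^esub> b = b) \<longrightarrow> e i \<triangleright>\<^bsub>P\<^esub> p = p"
    using ex [OF x(1)] unfolding x(2) by (elim exE conjE)
  obtain i where "i \<in> I" "\<forall>b\<in>F. e i \<otimes>\<^bsub>B\<^esub> b = b \<and> b \<otimes>\<^bsub>B\<^esub> e i = b"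
    using local_units F(1,2) unfolding idempotent_local_units_def by meson
  then show thesis using that F(3) by meson
qed

text \<open>If \<open>u\<close> is a local unit that fixes \<open>p\<close>, then so does every local unit \<open>e\<^sub>i\<close> with \<open>e\<^sub>i u = u\<close>;
  likewise for functionals, with \<open>u e\<^sub>i = u\<close>. Hence it suffices to apply the definition of local units
  to the given elements of \<open>B\<close> together with one local unit for each of the given elements of \<open>P\<close> and
  \<open>P\<^sup>\<dagger>\<close>.\<close>

lemma common_unit:
  assumes F: "finite F" "F \<subseteq> carrier B" and Y: "finite Y" "Y \<subseteq> carrier P"
    and \<Phi>: "finite \<Phi>" "\<Phi> \<subseteq> carrier Pd"
  obtains i where "i \<in> I" "\<forall>b\<in>F. e i \<otimes>\<^bsub>B\<^esub> b = b \<and> b \<otimes>\<^bsub>B\<^esub> e i = b"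
    "\<forall>p\<in>Y. e i \<triangleright>\<^bsub>P\<^esub> p = p"
    "\<forall>\<phi>\<in>\<Phi>. \<forall>p\<in>carrier P. \<phi> (e i \<triangleright>\<^bsub>P\<^esub> p) = \<phi> p"
proof -
  have "\<forall>p\<in>Y. \<exists>i. i \<in> I \<and> e i \<triangleright>\<^bsub>P\<^esub> p = p"
    using unit_for_element Y(2) by (metis subsetD)
  then obtain u where u: "\<And>p. p \<in> Y \<Longrightarrow> u p \<in> I \<and> e (u p) \<triangleright>\<^bsub>P\<^esub> p = p"
    by metis
  have "\<forall>\<phi>\<in>\<Phi>. \<exists>i. i \<in> I \<and> (\<forall>p\<in>carrier P. \<phi> (e i \<triangleright>\<^bsub>P\<^esub> p) = \<phi> p)"
    using \<Phi>(2) by (auto simp: carrier_Pd)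
  then obtain w where w: "\<And>\<phi>. \<phi> \<in> \<Phi> \<Longrightarrow> w \<phi> \<in> I \<and> (\<forall>p\<in>carrier P. \<phi> (e (w \<phi>) \<triangleright>\<^bsub>P\<^esub> p) = \<phi> p)"
    by metis
  let ?F = "F \<union> e ` u ` Y \<union> e ` w ` \<Phi>"
  have "finite ?F \<and> ?F \<subseteq> carrier B"
    using F Y(1) \<Phi>(1) u w e_closed by auto
  then obtain i where i: "i \<in> I" "\<forall>b\<in>?F. e i \<otimes>\<^bsub>B\<^esub> b = b \<and> b \<otimes>\<^bsub>B\<^esub> e i = b"
    using local_units unfolding idempotent_local_units_def by meson
  show thesis
  proof (rule that [of i]; (intro ballI)?)
    fix p assume p: "p \<in> Y"
    then have "e i \<otimes>\<^bsub>B\<^esub> e (u p) = e (u p)" "u p \<in> I" "p \<in> carrier P"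
      using i(2) u Y(2) by auto
    then have "e i \<triangleright>\<^bsub>P\<^esub> (e (u p) \<triangleright>\<^bsub>P\<^esub> p) = e (u p) \<triangleright>\<^bsub>P\<^esub> p"
      using i(1) by (simp add: e_closed flip: P.lact_assoc)
    then show "e i \<triangleright>\<^bsub>P\<^esub> p = p" using u [OF p] by simp
  next
    fix \<phi> p assume \<phi>: "\<phi> \<in> \<Phi>" and p: "p \<in> carrier P"
    have "\<phi> (e i \<triangleright>\<^bsub>P\<^esub> p) = \<phi> (e (w \<phi>) \<triangleright>\<^bsub>P\<^esub> (e i \<triangleright>\<^bsub>P\<^esub> p))"
      using w [OF \<phi>] p i by (simp add: e_lact_closed)
    also have "\<dots> = \<phi> (e (w \<phi>) \<triangleright>\<^bsub>P\<^esub> p)"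
      using w [OF \<phi>] \<phi> p i by (simp add: e_closed flip: P.lact_assoc)
    also have "\<dots> = \<phi> p" using w [OF \<phi>] p by simp
    finally show "\<phi> (e i \<triangleright>\<^bsub>P\<^esub> p) = \<phi> p" .
  qed (use i in auto)
qed

subsection \<open>The objects of the direct system and the vertex of the cocone\<close>

lemma nonunital_algebra_B_at:
  assumes i: "i \<in> I" shows "nonunital_algebra k (B_at i)"
proof -
  let ?H = "carrier (B_at i)"
  have upd: "B_at i = B\<lparr>carrier := ?H\<rparr>\<lparr>monoid.one := e i\<rparr>"
    by (simp add: corner_def)
  have ops: "ring.add (B_at i) = ring.add B" "ring.zero (B_at i) = ring.zero B"
    "monoid.mult (B_at i) = monoid.mult B" "smult (B_at i) = smult B"
    by (simp_all add: corner_def)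
  note simps = carrier_B_at [OF i] e_closed [OF i] P.R.mult_closed P.R.mult_l_distr
    P.R.mult_r_distr P.R.smult_mult_l P.R.smult_mult_r P.R.mult_zero_left P.R.mult_zero_right
  interpret H: module k "B\<lparr>carrier := ?H\<rparr>"
    by (rule P.R.module_carrier_update) (auto simp: simps)
  interpret H': module k "B_at i"
  proof (rule moduleI)
    show "abelian_group (B_at i)"
      by (rule abelian_groupI)
        (use H.M.a_closed H.M.zero_closed H.M.a_assoc H.M.a_comm H.M.l_zero H.M.add.l_inv_ex
          in \<open>auto simp: ops\<close>)
  qed (use H.smult_closed H.smult_l_distr H.smult_r_distr H.smult_assoc1 H.smult_one
      in \<open>auto simp: ops A.R.is_cring\<close>)
  have mult: "x \<otimes>\<^bsub>B\<^esub> y \<in> ?H" if "x \<in> ?H" "y \<in> ?H" for x y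
  proof -
    have "e i \<otimes>\<^bsub>B\<^esub> (x \<otimes>\<^bsub>B\<^esub> y) = x \<otimes>\<^bsub>B\<^esub> y"
      using that by (simp add: simps flip: P.R.mult_assoc)
    moreover have "x \<otimes>\<^bsub>B\<^esub> y \<otimes>\<^bsub>B\<^esub> e i = x \<otimes>\<^bsub>B\<^esub> y"
      using that by (simp add: simps P.R.mult_assoc)
    ultimately show ?thesis
      using that by (simp add: simps)
  qed
  show ?thesis
    by unfold_locales
      (use mult in \<open>auto simp: ops carrier_B_at [OF i] P.R.mult_assoc P.R.mult_l_distr
        P.R.mult_r_distr P.R.smult_mult_l P.R.smult_mult_r\<close>)
qed

lemma B_at_ops:
  "ring.add (B_at i) = ring.add B" "monoid.mult (B_at i) = monoid.mult B" "smult (B_at i) = smult B"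
  by (simp_all add: corner_def)

lemma P_at_ops:
  "ring.zero (P_at i) = ring.zero P" "ring.add (P_at i) = ring.add P" "smult (P_at i) = smult P"
  "ract (P_at i) = ract P" "lact (P_at i) = lact P"
  by (simp_all add: component_def)

lemma Pd_ops:
  "ring.zero Pd = ring.zero D" "ring.add Pd = ring.add D" "smult Pd = smult D"
  "ract Pd = ract D" "lact Pd = lact D"
  by (simp_all add: dagger_def)

lemma bimodule_P_at:
  assumes i: "i \<in> I" shows "bimodule k (B_at i) A (P_at i)"
proof -
  have "bimodule k (B_at i) A (P\<lparr>carrier := carrier (P_at i)\<rparr>)"
  proof (rule bimodule_restrict [OF P.bimodule_axioms nonunital_algebra_B_at [OF i]])
    fix b p assume "b \<in> carrier (B_at i)" "p \<in> carrier (P_at i)"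
    then show "b \<triangleright>\<^bsub>P\<^esub> p \<in> carrier (P_at i)"
      by (auto simp: carrier_B_at [OF i] carrier_P_at [OF i] P.lact_closed e_closed [OF i]
          simp flip: P.lact_assoc)
  qed (auto simp: carrier_B_at [OF i] carrier_P_at [OF i] B_at_ops P.lact_zero e_closed [OF i]
      P.lact_add_r P.lact_smult P.ract_closed simp flip: P.lact_ract)
  then show ?thesis by (simp add: component_def)
qed

lemma dual_of_bimodule_P_at:
  assumes i: "i \<in> I" shows "dual_of_bimodule k A (B_at i) (P_at i)"
  using bimodule_P_at [OF i] right_unital A.unital_algebra_axioms
  by (intro dual_of_bimodule.intro dual_of_bimodule_axioms.intro)
    (auto simp: right_unital_def carrier_P_at [OF i] P_at_ops)

lemma bimodule_Pd: "bimodule k A B Pd"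
proof -
  interpret D: bimodule k A B D by (rule bimodule_dual)
  have "bimodule k A B (D\<lparr>carrier := carrier Pd\<rparr>)"
  proof (rule bimodule_restrict [OF bimodule_dual])
    show "\<zero>\<^bsub>D\<^esub> \<in> carrier Pd"
      by (rule common_unit [of "{}" "{}" "{}"])
        (auto simp: carrier_Pd dual_closed dual_apply e_lact_closed)
  next
    fix \<phi> \<psi> assume \<phi>\<psi>: "\<phi> \<in> carrier Pd" "\<psi> \<in> carrier Pd"
    obtain i where "i \<in> I" "\<forall>\<chi>\<in>{\<phi>, \<psi>}. \<forall>p\<in>carrier P. \<chi> (e i \<triangleright>\<^bsub>P\<^esub> p) = \<chi> p"
      by (rule common_unit [of "{}" "{}" "{\<phi>, \<psi>}"]) (use \<phi>\<psi> in auto)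
    then have "\<forall>p\<in>carrier P. (\<phi> \<oplus>\<^bsub>D\<^esub> \<psi>) (e i \<triangleright>\<^bsub>P\<^esub> p) = (\<phi> \<oplus>\<^bsub>D\<^esub> \<psi>) p"
      by (simp add: dual_apply e_lact_closed)
    with \<phi>\<psi> \<open>i \<in> I\<close> show "\<phi> \<oplus>\<^bsub>D\<^esub> \<psi> \<in> carrier Pd"
      by (auto simp: carrier_Pd dual_closed)
  next
    fix \<phi> b assume \<phi>: "\<phi> \<in> carrier Pd" and b: "b \<in> carrier B"
    obtain i where "i \<in> I" "b \<otimes>\<^bsub>B\<^esub> e i = b"
      by (rule common_unit [of "{b}" "{}" "{}"]) (use b in auto)
    then have "\<forall>p\<in>carrier P. (\<phi> \<triangleleft>\<^bsub>D\<^esub> b) (e i \<triangleright>\<^bsub>P\<^esub> p) = (\<phi> \<triangleleft>\<^bsub>D\<^esub> b) p"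
      using b by (simp add: dual_apply e_lact_closed e_closed flip: P.lact_assoc)
    with \<phi> b \<open>i \<in> I\<close> show "\<phi> \<triangleleft>\<^bsub>D\<^esub> b \<in> carrier Pd"
      by (auto simp: carrier_Pd dual_closed)
  qed (auto simp: carrier_Pd dual_closed dual_apply e_lact_closed
      A.nonunital_algebra_axioms, metis+)
  then show ?thesis by (simp add: dagger_def)
qed

lemma left_unital_Pd: "left_unital A Pd"
  using left_unital_dual by (auto simp: left_unital_def carrier_Pd Pd_ops)

lemma tensor_bimodules_G:
  assumes i: "i \<in> I" shows "tensor_bimodules k A (B_at i) A (D_at i) (P_at i)"
  by (intro tensor_bimodules.intro dual_of_bimodule.bimodule_dual dual_of_bimodule_P_at
      bimodule_P_at i)

sublocale L: tensor_bimodules k A B A Pd P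
  by (intro tensor_bimodules.intro bimodule_Pd P.bimodule_axioms)

lemma unital_bimodule_G:
  assumes i: "i \<in> I" shows "unital_bimodule k A (G i)"
proof -
  interpret Gi: tensor_bimodules k A "B_at i" A "D_at i" "P_at i"
    by (rule tensor_bimodules_G [OF i])
  interpret Di: dual_of_bimodule k A "B_at i" "P_at i"
    by (rule dual_of_bimodule_P_at [OF i])
  show ?thesis
    unfolding unital_bimodule_def G_obj_def
    by (intro conjI Gi.bimodule_tensor Gi.left_unital_tensor Gi.right_unital_tensor Di.left_unital_dual
        Di.right_unital A.one_closed)
qed

lemma unital_bimodule_L: "unital_bimodule k A L"
  unfolding unital_bimodule_def
  by (intro conjI L.bimodule_tensor L.left_unital_tensor L.right_unital_tensor left_unital_Pd
      right_unital A.one_closed)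

subsection \<open>Restriction and inflation of functionals\<close>

abbreviation "restr i \<phi> \<equiv> restrict \<phi> (carrier (P_at i))"
abbreviation "inflate i \<psi> \<equiv> compose (carrier P) \<psi> (proj P e i)"
abbreviation "inflate_to j i \<psi> \<equiv> compose (carrier (P_at j)) \<psi> (proj_between P e i j)"

lemma P_at_subset: "\<lbrakk>i \<in> I; p \<in> carrier (P_at i)\<rbrakk> \<Longrightarrow> p \<in> carrier P"
  by (simp add: carrier_P_at)

lemma B_at_subset: "\<lbrakk>i \<in> I; b \<in> carrier (B_at i)\<rbrakk> \<Longrightarrow> b \<in> carrier B"
  by (simp add: carrier_B_at)

lemma Pd_subset: "\<phi> \<in> carrier Pd \<Longrightarrow> \<phi> \<in> carrier D"
  by (simp add: carrier_Pd)

lemma e_lact_P_at: "\<lbrakk>i \<in> I; p \<in> carrier P\<rbrakk> \<Longrightarrow> e i \<triangleright>\<^bsub>P\<^esub> p \<in> carrier (P_at i)"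
  by (simp add: carrier_P_at e_lact_closed e_lact_idem)

lemma P_at_closed:
  assumes "i \<in> I" "p \<in> carrier (P_at i)"
  shows "q \<in> carrier (P_at i) \<Longrightarrow> p \<oplus>\<^bsub>P\<^esub> q \<in> carrier (P_at i)"
    and "c \<in> carrier k \<Longrightarrow> c \<odot>\<^bsub>P\<^esub> p \<in> carrier (P_at i)"
    and "a \<in> carrier A \<Longrightarrow> p \<triangleleft>\<^bsub>P\<^esub> a \<in> carrier (P_at i)"
    and "b \<in> carrier (B_at i) \<Longrightarrow> b \<triangleright>\<^bsub>P\<^esub> p \<in> carrier (P_at i)"
proof -
  interpret Pi: bimodule k "B_at i" A "P_at i" by (rule bimodule_P_at [OF assms(1)])
  show "q \<in> carrier (P_at i) \<Longrightarrow> p \<oplus>\<^bsub>P\<^esub> q \<in> carrier (P_at i)"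
    "c \<in> carrier k \<Longrightarrow> c \<odot>\<^bsub>P\<^esub> p \<in> carrier (P_at i)"
    "a \<in> carrier A \<Longrightarrow> p \<triangleleft>\<^bsub>P\<^esub> a \<in> carrier (P_at i)"
    "b \<in> carrier (B_at i) \<Longrightarrow> b \<triangleright>\<^bsub>P\<^esub> p \<in> carrier (P_at i)"
    using assms(2) Pi.M.a_closed Pi.smult_closed Pi.ract_closed Pi.lact_closed
    by (simp_all add: P_at_ops)
qed

lemma D_at_iff:
  assumes "i \<in> I"
  shows "\<psi> \<in> carrier (D_at i) \<longleftrightarrow> \<psi> \<in> carrier (P_at i) \<rightarrow>\<^sub>E carrier A \<and>
    (\<forall>p\<in>carrier (P_at i). \<forall>q\<in>carrier (P_at i). \<psi> (p \<oplus>\<^bsub>P\<^esub> q) = \<psi> p \<oplus>\<^bsub>A\<^esub> \<psi> q) \<and>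
    (\<forall>p\<in>carrier (P_at i). \<forall>a\<in>carrier A. \<psi> (p \<triangleleft>\<^bsub>P\<^esub> a) = \<psi> p \<otimes>\<^bsub>A\<^esub> a)"
  using dual_of_bimodule.dual_iff [OF dual_of_bimodule_P_at [OF assms]] by (simp add: P_at_ops)

lemma D_atD:
  assumes "i \<in> I" "\<psi> \<in> carrier (D_at i)" "p \<in> carrier (P_at i)"
  shows "\<psi> p \<in> carrier A"
    and "q \<in> carrier (P_at i) \<Longrightarrow> \<psi> (p \<oplus>\<^bsub>P\<^esub> q) = \<psi> p \<oplus>\<^bsub>A\<^esub> \<psi> q"
    and "a \<in> carrier A \<Longrightarrow> \<psi> (p \<triangleleft>\<^bsub>P\<^esub> a) = \<psi> p \<otimes>\<^bsub>A\<^esub> a"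
  using assms(2,3) by (auto simp: D_at_iff [OF assms(1)])

lemma D_at_eqI:
  assumes "i \<in> I" "\<phi> \<in> carrier (D_at i)" "\<psi> \<in> carrier (D_at i)"
    and "\<And>p. p \<in> carrier (P_at i) \<Longrightarrow> \<phi> p = \<psi> p"
  shows "\<phi> = \<psi>"
  using dual_of_bimodule.dual_eqI [OF dual_of_bimodule_P_at [OF assms(1)]] assms by metis

lemma D_at_apply:
  assumes "i \<in> I" "p \<in> carrier (P_at i)"
  shows "(\<phi> \<oplus>\<^bsub>D_at i\<^esub> \<psi>) p = \<phi> p \<oplus>\<^bsub>A\<^esub> \<psi> p"
    and "(c \<odot>\<^bsub>D_at i\<^esub> \<phi>) p = c \<odot>\<^bsub>A\<^esub> \<phi> p"
    and "(\<phi> \<triangleleft>\<^bsub>D_at i\<^esub> b) p = \<phi> (b \<triangleright>\<^bsub>P\<^esub> p)"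
    and "(a \<triangleright>\<^bsub>D_at i\<^esub> \<phi>) p = a \<otimes>\<^bsub>A\<^esub> \<phi> p"
  using dual_of_bimodule.dual_apply [OF dual_of_bimodule_P_at [OF assms(1)] assms(2)]
  by (simp_all add: P_at_ops)

lemma D_at_closed:
  assumes "i \<in> I" "\<phi> \<in> carrier (D_at i)"
  shows "\<psi> \<in> carrier (D_at i) \<Longrightarrow> \<phi> \<oplus>\<^bsub>D_at i\<^esub> \<psi> \<in> carrier (D_at i)"
    and "c \<in> carrier k \<Longrightarrow> c \<odot>\<^bsub>D_at i\<^esub> \<phi> \<in> carrier (D_at i)"
    and "b \<in> carrier (B_at i) \<Longrightarrow> \<phi> \<triangleleft>\<^bsub>D_at i\<^esub> b \<in> carrier (D_at i)"
    and "a \<in> carrier A \<Longrightarrow> a \<triangleright>\<^bsub>D_at i\<^esub> \<phi> \<in> carrier (D_at i)"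
  using dual_of_bimodule.dual_closed [OF dual_of_bimodule_P_at [OF assms(1)]] assms(2) by auto

lemma restr_closed:
  assumes i: "i \<in> I" and "\<phi> \<in> carrier D"
  shows "restr i \<phi> \<in> carrier (D_at i)"
  using assms by (auto simp: D_at_iff P_at_closed dualD P_at_subset [OF i])

lemma inflate_apply: "p \<in> carrier P \<Longrightarrow> inflate i \<psi> p = \<psi> (e i \<triangleright>\<^bsub>P\<^esub> p)"
  by (simp add: compose_def proj_def)

lemma incl_apply: "p \<in> carrier (P_at i) \<Longrightarrow> incl P e i p = p"
  by (simp add: incl_def)

text \<open>Restriction \<open>restr i\<close> along \<open>\<sigma>\<^sub>i\<close> and inflation \<open>inflate i\<close> along \<open>\<tau>\<^sub>i\<close> identify \<open>P\<^sub>i\<^sup>*\<close> with the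
  functionals in \<open>P\<^sup>\<dagger>\<close> that are fixed by \<open>e\<^sub>i\<close>; see \<open>restr_inflate\<close> and \<open>inflate_restr\<close>. Under
  this identification the maps on functionals that underlie the transition maps and the cocone
  become inclusions, and so the equations between them come down to evaluation on \<open>P\<close>.\<close>

lemma inflate_closed:
  assumes i: "i \<in> I" and \<psi>: "\<psi> \<in> carrier (D_at i)"
  shows "inflate i \<psi> \<in> carrier Pd"
proof -
  have "inflate i \<psi> \<in> carrier D"
    unfolding dual_iff
    using \<psi> e_lact_P_at [OF i] e_closed [OF i]
    by (auto simp: inflate_apply P.ract_closed P.lact_add_r P.lact_ract [symmetric] D_atD [OF i])
      (simp add: compose_def)
  moreover have "\<forall>p\<in>carrier P. inflate i \<psi> (e i \<triangleright>\<^bsub>P\<^esub> p) = inflate i \<psi> p"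
    using i by (simp add: inflate_apply e_lact_closed e_lact_idem)
  ultimately show ?thesis
    using i by (auto simp: carrier_Pd)
qed

lemma restr_inflate:
  assumes i: "i \<in> I" and \<psi>: "\<psi> \<in> carrier (D_at i)"
  shows "restr i (inflate i \<psi>) = \<psi>"
  using restr_closed [OF i] inflate_closed [OF i \<psi>] \<psi>
  by (intro D_at_eqI [OF i]) (auto simp: inflate_apply carrier_P_at [OF i] Pd_subset)

text \<open>The transition maps need no separate treatment: on functionals they are inflation to \<open>P\<close> followed
  by restriction.\<close>

lemma inflate_to_eq_restr_inflate: "j \<in> I \<Longrightarrow> inflate_to j i \<psi> = restr j (inflate i \<psi>)"
  by (auto simp: fun_eq_iff compose_def proj_def proj_between_def restrict_def
      P_at_subset [of j])

lemma idem_leD: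
  assumes "i \<in> I" "j \<in> I" "idem_le B e i j" "p \<in> carrier P"
  shows "e i \<triangleright>\<^bsub>P\<^esub> (e j \<triangleright>\<^bsub>P\<^esub> p) = e i \<triangleright>\<^bsub>P\<^esub> p" "e j \<triangleright>\<^bsub>P\<^esub> (e i \<triangleright>\<^bsub>P\<^esub> p) = e i \<triangleright>\<^bsub>P\<^esub> p"
  using assms by (simp_all add: idem_le_def e_closed flip: P.lact_assoc)

lemma idem_le_P_at:
  assumes ij: "i \<in> I" "j \<in> I" "idem_le B e i j" and p: "p \<in> carrier (P_at i)"
  shows "p \<in> carrier (P_at j)"
  using idem_leD(2) [OF ij, of p] p by (simp add: carrier_P_at ij)

lemma idem_le_B_at:
  assumes ij: "i \<in> I" "j \<in> I" "idem_le B e i j" and b: "b \<in> carrier (B_at i)"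
  shows "b \<in> carrier (B_at j)"
proof -
  have b': "b \<in> carrier B" "e i \<otimes>\<^bsub>B\<^esub> b = b" "b \<otimes>\<^bsub>B\<^esub> e i = b"
    using b by (simp_all add: carrier_B_at ij)
  have "e j \<otimes>\<^bsub>B\<^esub> (e i \<otimes>\<^bsub>B\<^esub> b) = e i \<otimes>\<^bsub>B\<^esub> b" "(b \<otimes>\<^bsub>B\<^esub> e i) \<otimes>\<^bsub>B\<^esub> e j = b \<otimes>\<^bsub>B\<^esub> e i"
    using ij b'(1) by (simp_all add: idem_le_def e_closed P.R.mult_assoc flip: P.R.mult_assoc [of "e j"])
  then show ?thesis
    using b' by (simp add: carrier_B_at ij)
qed

text \<open>At \<open>p\<close>, the two sides of the last equation are \<open>\<psi> (b e\<^sub>i p)\<close> and \<open>\<psi> (e\<^sub>i b p)\<close>; for \<open>b\<close> in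
  the corner \<open>b e\<^sub>i = b = e\<^sub>i b\<close>.\<close>

lemma inflate_ops:
  assumes i: "i \<in> I" and \<psi>: "\<psi> \<in> carrier (D_at i)"
  shows "\<psi>' \<in> carrier (D_at i) \<Longrightarrow> inflate i (\<psi> \<oplus>\<^bsub>D_at i\<^esub> \<psi>') = inflate i \<psi> \<oplus>\<^bsub>D\<^esub> inflate i \<psi>'"
    and "c \<in> carrier k \<Longrightarrow> inflate i (c \<odot>\<^bsub>D_at i\<^esub> \<psi>) = c \<odot>\<^bsub>D\<^esub> inflate i \<psi>"
    and "a \<in> carrier A \<Longrightarrow> inflate i (a \<triangleright>\<^bsub>D_at i\<^esub> \<psi>) = a \<triangleright>\<^bsub>D\<^esub> inflate i \<psi>"
    and "b \<in> carrier (B_at i) \<Longrightarrow> inflate i (\<psi> \<triangleleft>\<^bsub>D_at i\<^esub> b) = inflate i \<psi> \<triangleleft>\<^bsub>D\<^esub> b"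
proof -
  note ext = Pd_subset [OF inflate_closed [OF i]]
  show "\<psi>' \<in> carrier (D_at i) \<Longrightarrow> inflate i (\<psi> \<oplus>\<^bsub>D_at i\<^esub> \<psi>') = inflate i \<psi> \<oplus>\<^bsub>D\<^esub> inflate i \<psi>'"
    "c \<in> carrier k \<Longrightarrow> inflate i (c \<odot>\<^bsub>D_at i\<^esub> \<psi>) = c \<odot>\<^bsub>D\<^esub> inflate i \<psi>"
    "a \<in> carrier A \<Longrightarrow> inflate i (a \<triangleright>\<^bsub>D_at i\<^esub> \<psi>) = a \<triangleright>\<^bsub>D\<^esub> inflate i \<psi>"
    by (auto intro!: dual_eqI simp: ext dual_closed D_at_closed i \<psi> dual_apply inflate_apply
        D_at_apply e_lact_P_at)
  assume b: "b \<in> carrier (B_at i)"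
  then have b': "b \<in> carrier B" "e i \<otimes>\<^bsub>B\<^esub> b = b" "b \<otimes>\<^bsub>B\<^esub> e i = b"
    by (simp_all add: carrier_B_at i)
  show "inflate i (\<psi> \<triangleleft>\<^bsub>D_at i\<^esub> b) = inflate i \<psi> \<triangleleft>\<^bsub>D\<^esub> b"
    using b'
    by (intro dual_eqI) (simp_all add: ext dual_closed D_at_closed b i \<psi> dual_apply inflate_apply
        D_at_apply e_lact_P_at P.lact_closed e_closed flip: P.lact_assoc)
qed

lemma restr_ops:
  assumes i: "i \<in> I" and \<phi>: "\<phi> \<in> carrier D"
  shows "\<phi>' \<in> carrier D \<Longrightarrow> restr i (\<phi> \<oplus>\<^bsub>D\<^esub> \<phi>') = restr i \<phi> \<oplus>\<^bsub>D_at i\<^esub> restr i \<phi>'"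
    and "c \<in> carrier k \<Longrightarrow> restr i (c \<odot>\<^bsub>D\<^esub> \<phi>) = c \<odot>\<^bsub>D_at i\<^esub> restr i \<phi>"
    and "a \<in> carrier A \<Longrightarrow> restr i (a \<triangleright>\<^bsub>D\<^esub> \<phi>) = a \<triangleright>\<^bsub>D_at i\<^esub> restr i \<phi>"
    and "b \<in> carrier (B_at i) \<Longrightarrow> restr i (\<phi> \<triangleleft>\<^bsub>D\<^esub> b) = restr i \<phi> \<triangleleft>\<^bsub>D_at i\<^esub> b"
  by (auto intro!: D_at_eqI [OF i] simp: restr_closed dual_closed D_at_closed i \<phi> dual_apply
      D_at_apply P_at_subset [OF i] P_at_closed B_at_subset [OF i])

subsection \<open>The transition maps and the cocone\<close>

lemma g_morphism:
  assumes i: "i \<in> I"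
  shows "tensor_bimodule_morphism k A (B_at i) A (D_at i) (P_at i) B Pd P (inflate i) (incl P e i)"
proof -
  interpret Gi: tensor_bimodules k A "B_at i" A "D_at i" "P_at i" by (rule tensor_bimodules_G [OF i])
  show ?thesis
  proof unfold_locales
    fix \<psi> b p assume "\<psi> \<in> carrier (D_at i)" "b \<in> carrier (B_at i)" "p \<in> carrier (P_at i)"
    then show "pure_L (inflate i (\<psi> \<triangleleft>\<^bsub>D_at i\<^esub> b)) (incl P e i p) =
        pure_L (inflate i \<psi>) (incl P e i (b \<triangleright>\<^bsub>P_at i\<^esub> p))"
      using L.pure_balanced [of "inflate i \<psi>" b p]
      by (simp add: inflate_ops i incl_apply P_at_ops P_at_closed Pd_ops inflate_closed
          B_at_subset [OF i] P_at_subset [OF i])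
  qed (simp_all add: inflate_closed i incl_apply P_at_ops P_at_closed Pd_ops P_at_subset [OF i]
      inflate_ops)
qed

lemma G_morphism:
  assumes ij: "i \<in> I" "j \<in> I" "idem_le B e i j"
  shows "tensor_bimodule_morphism k A (B_at i) A (D_at i) (P_at i)
    (B_at j) (D_at j) (P_at j) (inflate_to j i) (incl P e i)"
proof -
  interpret Gi: tensor_bimodules k A "B_at i" A "D_at i" "P_at i"
    by (rule tensor_bimodules_G [OF ij(1)])
  interpret Gj: tensor_bimodules k A "B_at j" A "D_at j" "P_at j"
    by (rule tensor_bimodules_G [OF ij(2)])
  note simps = inflate_to_eq_restr_inflate [OF ij(2)] inflate_ops restr_ops inflate_closed
    Pd_subset restr_closed ij incl_apply P_at_ops P_at_closed idem_le_P_at [OF ij]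
    idem_le_B_at [OF ij]
  show ?thesis
  proof unfold_locales
    fix \<psi> b p assume "\<psi> \<in> carrier (D_at i)" "b \<in> carrier (B_at i)" "p \<in> carrier (P_at i)"
    then show "pure_at j (inflate_to j i (\<psi> \<triangleleft>\<^bsub>D_at i\<^esub> b)) (incl P e i p) =
        pure_at j (inflate_to j i \<psi>) (incl P e i (b \<triangleright>\<^bsub>P_at i\<^esub> p))"
      using Gj.pure_balanced [of "inflate_to j i \<psi>" b p]
      by (simp add: simps)
  qed (simp_all add: simps)
qed

lemma G_tr_hom: "\<lbrakk>i \<in> I; j \<in> I; idem_le B e i j\<rbrakk> \<Longrightarrow> G_tr j i \<in> bimod_hom k A A (G i) (G j)"
  unfolding G_map_def G_obj_def by (rule tensor_bimodule_morphism.map_bimod_hom [OF G_morphism])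

lemma G_tr_pure:
  assumes "i \<in> I" "j \<in> I" "idem_le B e i j" "\<psi> \<in> carrier (D_at i)" "p \<in> carrier (P_at i)"
  shows "G_tr j i (pure_at i \<psi> p) = pure_at j (inflate_to j i \<psi>) p"
proof -
  interpret tensor_bimodule_morphism k A "B_at i" A "D_at i" "P_at i"
    "B_at j" "D_at j" "P_at j" "inflate_to j i" "incl P e i"
    by (rule G_morphism [OF assms(1-3)])
  show ?thesis
    using map_pure [OF assms(4,5)] assms(5) by (simp add: G_map_def incl_apply)
qed

lemma g_hom: "i \<in> I \<Longrightarrow> g i \<in> bimod_hom k A A (G i) L"
  unfolding g_map_def G_obj_def by (rule tensor_bimodule_morphism.map_bimod_hom [OF g_morphism])

lemma g_pure:
  assumes "i \<in> I" "\<psi> \<in> carrier (D_at i)" "p \<in> carrier (P_at i)"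
  shows "g i (pure_at i \<psi> p) = pure_L (inflate i \<psi>) (incl P e i p)"
proof -
  interpret tensor_bimodule_morphism k A "B_at i" A "D_at i" "P_at i" B Pd P "inflate i" "incl P e i"
    by (rule g_morphism [OF assms(1)])
  show ?thesis
    using map_pure [OF assms(2,3)] by (simp add: g_map_def)
qed

lemma pure_at_closed:
  "\<lbrakk>i \<in> I; \<psi> \<in> carrier (D_at i); p \<in> carrier (P_at i)\<rbrakk> \<Longrightarrow> pure_at i \<psi> p \<in> carrier (G i)"
  unfolding G_obj_def
  by (rule tensor_product.pure_closed)
    (use tensor_bimodules_G in \<open>auto simp: tensor_product_def tensor_bimodules_def bimodule_def\<close>)

lemma G_hom_eqI:
  assumes i: "i \<in> I" and "f \<in> bimod_hom k A A (G i) Q" "f' \<in> bimod_hom k A A (G i) Q"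
    and "\<And>\<psi> p. \<lbrakk>\<psi> \<in> carrier (D_at i); p \<in> carrier (P_at i)\<rbrakk> \<Longrightarrow>
      f (pure_at i \<psi> p) = f' (pure_at i \<psi> p)"
  shows "f = f'"
proof -
  interpret Gi: tensor_bimodules k A "B_at i" A "D_at i" "P_at i" by (rule tensor_bimodules_G [OF i])
  show ?thesis
    using assms unfolding G_obj_def by (intro Gi.bimod_hom_eqI) auto
qed

lemma bimodule_G: "i \<in> I \<Longrightarrow> bimodule k A A (G i)"
  using unital_bimodule_G by (simp add: unital_bimodule_def)

lemma inflate_inflate_to:
  assumes ij: "i \<in> I" "j \<in> I" "idem_le B e i j" and \<psi>: "\<psi> \<in> carrier (D_at i)"
  shows "inflate j (inflate_to j i \<psi>) = inflate i \<psi>"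
  by (auto simp: fun_eq_iff compose_def proj_def proj_between_def restrict_def e_lact_P_at
      ij idem_leD [OF ij])

lemma inflate_to_closed:
  assumes "i \<in> I" "j \<in> I" "\<psi> \<in> carrier (D_at i)"
  shows "inflate_to j i \<psi> \<in> carrier (D_at j)"
  using assms by (simp add: inflate_to_eq_restr_inflate restr_closed inflate_closed Pd_subset)

lemma direct_system_G: "direct_system k A I (idem_le B e) G G_tr"
  unfolding direct_system_def
proof (intro conjI ballI impI)
  fix i assume i: "i \<in> I"
  show "unital_bimodule k A (G i)" by (rule unital_bimodule_G [OF i])
  have ii: "idem_le B e i i" using i by (simp add: idem_le_def e_idem)
  show "G_tr i i = (\<lambda>x\<in>carrier (G i). x)"
  proof (rule G_hom_eqI [OF i G_tr_hom [OF i i ii] id_bimod_hom [OF bimodule_G [OF i]]])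
    fix \<psi> p assume "\<psi> \<in> carrier (D_at i)" "p \<in> carrier (P_at i)"
    then show "G_tr i i (pure_at i \<psi> p) = (\<lambda>x\<in>carrier (G i). x) (pure_at i \<psi> p)"
      using i ii by (simp add: G_tr_pure pure_at_closed inflate_to_eq_restr_inflate restr_inflate)
  qed
next
  fix i j l assume i: "i \<in> I" and j: "j \<in> I" and l: "l \<in> I"
    and "idem_le B e i j \<and> idem_le B e j l"
  then have ij: "idem_le B e i j" and jl: "idem_le B e j l" by auto
  have "e i \<otimes>\<^bsub>B\<^esub> e l = e i" "e l \<otimes>\<^bsub>B\<^esub> e i = e i"
  proof -
    have "e i \<otimes>\<^bsub>B\<^esub> e l = e i \<otimes>\<^bsub>B\<^esub> (e j \<otimes>\<^bsub>B\<^esub> e l)"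
      using i j l ij by (simp add: idem_le_def e_closed flip: P.R.mult_assoc)
    moreover have "e l \<otimes>\<^bsub>B\<^esub> e i = (e l \<otimes>\<^bsub>B\<^esub> e j) \<otimes>\<^bsub>B\<^esub> e i"
      using i j l ij by (simp add: idem_le_def e_closed P.R.mult_assoc)
    ultimately show "e i \<otimes>\<^bsub>B\<^esub> e l = e i" "e l \<otimes>\<^bsub>B\<^esub> e i = e i"
      using ij jl by (simp_all add: idem_le_def)
  qed
  then have il: "idem_le B e i l" by (simp add: idem_le_def)
  show "G_tr l i = compose (carrier (G i)) (G_tr l j) (G_tr j i)"
  proof (rule G_hom_eqI [OF i G_tr_hom [OF i l il]
        compose_bimod_hom [OF bimodule_G [OF i] G_tr_hom [OF i j ij] G_tr_hom [OF j l jl]]])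
    fix \<psi> p assume "\<psi> \<in> carrier (D_at i)" "p \<in> carrier (P_at i)"
    then show "G_tr l i (pure_at i \<psi> p) =
        compose (carrier (G i)) (G_tr l j) (G_tr j i) (pure_at i \<psi> p)"
      using i j l ij jl il
      by (simp add: compose_eq pure_at_closed G_tr_pure inflate_to_closed idem_le_P_at
          inflate_to_eq_restr_inflate [OF l] inflate_inflate_to)
  qed
qed (rule G_tr_hom)

lemma cocone_L: "cocone k A I (idem_le B e) G G_tr L g"
  unfolding cocone_def
proof (intro conjI ballI impI)
  fix i j assume i: "i \<in> I" and j: "j \<in> I" and ij: "idem_le B e i j"
  show "compose (carrier (G i)) (g j) (G_tr j i) = g i"
  proof (rule G_hom_eqI [OF i compose_bimod_hom [OF bimodule_G [OF i] G_tr_hom [OF i j ij] g_hom [OF j]]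
        g_hom [OF i]])
    fix \<psi> p assume "\<psi> \<in> carrier (D_at i)" "p \<in> carrier (P_at i)"
    then show "compose (carrier (G i)) (g j) (G_tr j i) (pure_at i \<psi> p) = g i (pure_at i \<psi> p)"
      using i j ij
      by (simp add: compose_eq pure_at_closed G_tr_pure g_pure inflate_to_closed
          idem_le_P_at [OF i j ij] incl_apply inflate_inflate_to)
  qed
qed (simp_all add: unital_bimodule_L g_hom)

subsection \<open>The universal property\<close>

text \<open>The indices at which \<open>\<phi> \<otimes> p\<close> comes from the direct system, namely from
  \<open>restr i \<phi> \<otimes> p\<close>.\<close>

definition supports :: "'i \<Rightarrow> ('p \<Rightarrow> 'a) \<Rightarrow> 'p \<Rightarrow> bool" where
  "supports i \<phi> p \<longleftrightarrow> i \<in> I \<and> e i \<triangleright>\<^bsub>P\<^esub> p = p \<and> (\<forall>q\<in>carrier P. \<phi> (e i \<triangleright>\<^bsub>P\<^esub> q) = \<phi> q)"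

lemma supports_P_at: "\<lbrakk>supports i \<phi> p; p \<in> carrier P\<rbrakk> \<Longrightarrow> p \<in> carrier (P_at i)"
  by (auto simp: supports_def carrier_P_at)

lemma ex_supports:
  assumes "\<phi> \<in> carrier Pd" "p \<in> carrier P" obtains i where "supports i \<phi> p"
  by (rule common_unit [of "{}" "{p}" "{\<phi>}"]) (use assms that in \<open>auto simp: supports_def\<close>)

lemma inflate_restr:
  assumes "supports i \<phi> p" "\<phi> \<in> carrier Pd"
  shows "inflate i (restr i \<phi>) = \<phi>"
  using assms
  by (intro dual_eqI)
    (auto simp: supports_def inflate_closed restr_closed Pd_subset inflate_apply e_lact_P_at)

lemma g_pure_restr:
  assumes "supports i \<phi> p" "\<phi> \<in> carrier Pd" "p \<in> carrier P"
  shows "g i (pure_at i (restr i \<phi>) p) = pure_L \<phi> p"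
proof -
  have "i \<in> I" "p \<in> carrier (P_at i)"
    using assms supports_P_at by (auto simp: supports_def)
  then show ?thesis
    using assms by (simp add: g_pure restr_closed Pd_subset inflate_restr incl_apply)
qed

context
  fixes Q :: "('k, 'a, 'a, 'q) bimod" and h
  assumes cocone: "cocone k A I (idem_le B e) G G_tr Q h"
begin

lemma bimodule_Q: "bimodule k A A Q"
  using cocone by (simp add: cocone_def unital_bimodule_def)

interpretation Q: bimodule k A A Q by (rule bimodule_Q)

lemma h_hom: "i \<in> I \<Longrightarrow> h i \<in> bimod_hom k A A (G i) Q"
  using cocone by (simp add: cocone_def)

lemma h_pure_le:
  assumes ij: "i \<in> I" "j \<in> I" "idem_le B e i j"
    and \<phi>: "\<phi> \<in> carrier Pd" "supports i \<phi> p" and p: "p \<in> carrier P"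
  shows "h j (pure_at j (restr j \<phi>) p) = h i (pure_at i (restr i \<phi>) p)"
proof -
  have p': "p \<in> carrier (P_at i)" by (rule supports_P_at [OF \<phi>(2) p])
  have \<phi>': "restr i \<phi> \<in> carrier (D_at i)" using ij(1) \<phi>(1) by (simp add: restr_closed Pd_subset)
  have "h i (pure_at i (restr i \<phi>) p) =
      compose (carrier (G i)) (h j) (G_tr j i) (pure_at i (restr i \<phi>) p)"
    using cocone ij by (simp add: cocone_def)
  also have "\<dots> = h j (pure_at j (inflate_to j i (restr i \<phi>)) p)"
    using ij p' \<phi>' by (simp add: compose_eq pure_at_closed G_tr_pure)
  also have "inflate_to j i (restr i \<phi>) = restr j \<phi>"
    using ij \<phi> by (simp add: inflate_to_eq_restr_inflate inflate_restr)
  finally show ?thesis ..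
qed

text \<open>Two supporting indices have a common upper bound since the order is directed, and passing from an
  index to a larger one is compatible with the cocone by \<open>h_pure_le\<close>.\<close>

lemma h_pure_unique:
  assumes "supports i \<phi> p" "supports j \<phi> p" and \<phi>: "\<phi> \<in> carrier Pd" and p: "p \<in> carrier P"
  shows "h i (pure_at i (restr i \<phi>) p) = h j (pure_at j (restr j \<phi>) p)"
proof -
  have ij: "i \<in> I" "j \<in> I" using assms by (auto simp: supports_def)
  obtain l where "l \<in> I" "idem_le B e i l" "idem_le B e j l"
    by (rule common_unit [of "{e i, e j}" "{}" "{}"])
      (use ij in \<open>auto simp: idem_le_def e_closed\<close>)
  then show ?thesis
    using h_pure_le [of i l \<phi> p] h_pure_le [of j l \<phi> p] assms ij by simp
qed

text \<open>The bilinear map \<open>(\<phi>, p) \<mapsto> h\<^sub>i (\<phi>|P\<^sub>i \<otimes> p)\<close> that induces the mediating morphism. The choice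
  of a supporting index \<open>i\<close> is immaterial by \<open>h_pure_unique\<close>.\<close>

definition h_bil :: "('p \<Rightarrow> 'a) \<Rightarrow> 'p \<Rightarrow> 'q" where
  "h_bil \<phi> p = (let i = SOME i. supports i \<phi> p in h i (pure_at i (restr i \<phi>) p))"

lemma h_bil_eq:
  assumes i: "supports i \<phi> p" and \<phi>: "\<phi> \<in> carrier Pd" and p: "p \<in> carrier P"
  shows "h_bil \<phi> p = h i (pure_at i (restr i \<phi>) p)"
  unfolding h_bil_def Let_def
  using h_pure_unique [OF someI [of "\<lambda>i. supports i \<phi> p", OF i] i \<phi> p] .

lemma h_pure_ops:
  assumes i: "i \<in> I" and \<psi>: "\<psi> \<in> carrier (D_at i)" and p: "p \<in> carrier (P_at i)"
  shows "h i (pure_at i \<psi> p) \<in> carrier Q"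
    and "\<psi>' \<in> carrier (D_at i) \<Longrightarrow> h i (pure_at i (\<psi> \<oplus>\<^bsub>D_at i\<^esub> \<psi>') p) =
      h i (pure_at i \<psi> p) \<oplus>\<^bsub>Q\<^esub> h i (pure_at i \<psi>' p)"
    and "p' \<in> carrier (P_at i) \<Longrightarrow> h i (pure_at i \<psi> (p \<oplus>\<^bsub>P\<^esub> p')) =
      h i (pure_at i \<psi> p) \<oplus>\<^bsub>Q\<^esub> h i (pure_at i \<psi> p')"
    and "b \<in> carrier (B_at i) \<Longrightarrow>
      h i (pure_at i (\<psi> \<triangleleft>\<^bsub>D_at i\<^esub> b) p) = h i (pure_at i \<psi> (b \<triangleright>\<^bsub>P\<^esub> p))"
    and "c \<in> carrier k \<Longrightarrow> h i (pure_at i (c \<odot>\<^bsub>D_at i\<^esub> \<psi>) p) = c \<odot>\<^bsub>Q\<^esub> h i (pure_at i \<psi> p)"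
    and "c \<in> carrier k \<Longrightarrow> h i (pure_at i \<psi> (c \<odot>\<^bsub>P\<^esub> p)) = c \<odot>\<^bsub>Q\<^esub> h i (pure_at i \<psi> p)"
    and "a \<in> carrier A \<Longrightarrow> h i (pure_at i (a \<triangleright>\<^bsub>D_at i\<^esub> \<psi>) p) = a \<triangleright>\<^bsub>Q\<^esub> h i (pure_at i \<psi> p)"
    and "a \<in> carrier A \<Longrightarrow> h i (pure_at i \<psi> (p \<triangleleft>\<^bsub>P\<^esub> a)) = h i (pure_at i \<psi> p) \<triangleleft>\<^bsub>Q\<^esub> a"
proof -
  interpret Gi: tensor_bimodules k A "B_at i" A "D_at i" "P_at i" by (rule tensor_bimodules_G [OF i])
  note hom = bimod_homD(2-) [OF h_hom [OF i], unfolded G_obj_def]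
  show "h i (pure_at i \<psi> p) \<in> carrier Q"
    using \<psi> p by (simp add: hom)
  show "\<psi>' \<in> carrier (D_at i) \<Longrightarrow> h i (pure_at i (\<psi> \<oplus>\<^bsub>D_at i\<^esub> \<psi>') p) =
      h i (pure_at i \<psi> p) \<oplus>\<^bsub>Q\<^esub> h i (pure_at i \<psi>' p)"
    using \<psi> p by (simp add: hom Gi.pure_add_left)
  show "p' \<in> carrier (P_at i) \<Longrightarrow> h i (pure_at i \<psi> (p \<oplus>\<^bsub>P\<^esub> p')) =
      h i (pure_at i \<psi> p) \<oplus>\<^bsub>Q\<^esub> h i (pure_at i \<psi> p')"
    using \<psi> p by (simp add: hom Gi.pure_add_right [unfolded P_at_ops])
  show "b \<in> carrier (B_at i) \<Longrightarrow>
      h i (pure_at i (\<psi> \<triangleleft>\<^bsub>D_at i\<^esub> b) p) = h i (pure_at i \<psi> (b \<triangleright>\<^bsub>P\<^esub> p))"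
    using \<psi> p by (simp add: Gi.pure_balanced [unfolded P_at_ops])
  show smult: "c \<in> carrier k \<Longrightarrow>
      h i (pure_at i (c \<odot>\<^bsub>D_at i\<^esub> \<psi>) p) = c \<odot>\<^bsub>Q\<^esub> h i (pure_at i \<psi> p)"
    using \<psi> p by (simp flip: hom Gi.smult_pure)
  then show "c \<in> carrier k \<Longrightarrow> h i (pure_at i \<psi> (c \<odot>\<^bsub>P\<^esub> p)) = c \<odot>\<^bsub>Q\<^esub> h i (pure_at i \<psi> p)"
    using \<psi> p by (simp flip: Gi.pure_smult [unfolded P_at_ops])
  show "a \<in> carrier A \<Longrightarrow> h i (pure_at i (a \<triangleright>\<^bsub>D_at i\<^esub> \<psi>) p) = a \<triangleright>\<^bsub>Q\<^esub> h i (pure_at i \<psi> p)"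
    using \<psi> p by (simp flip: hom Gi.lact_pure)
  show "a \<in> carrier A \<Longrightarrow> h i (pure_at i \<psi> (p \<triangleleft>\<^bsub>P\<^esub> a)) = h i (pure_at i \<psi> p) \<triangleleft>\<^bsub>Q\<^esub> a"
    using \<psi> p by (simp flip: hom Gi.ract_pure [unfolded P_at_ops])
qed

text \<open>Each identity involves finitely many functionals and elements, and elements of \<open>B\<close>, so it can be
  checked at a single index \<open>i\<close> that supports all of them; there it is an identity in
  \<open>P\<^sub>i\<^sup>* \<otimes> P\<^sub>i\<close> transported by the morphism \<open>h i\<close>. For balancedness over \<open>B\<close> the index is chosen
  such that \<open>b\<close> lies in the corner \<open>B\<^sub>i\<close>, where the tensor product is balanced.\<close>

lemma h_bil_ops:
  assumes \<phi>: "\<phi> \<in> carrier Pd" and p: "p \<in> carrier P"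
  shows "h_bil \<phi> p \<in> carrier Q"
    and "\<phi>' \<in> carrier Pd \<Longrightarrow> h_bil (\<phi> \<oplus>\<^bsub>Pd\<^esub> \<phi>') p = h_bil \<phi> p \<oplus>\<^bsub>Q\<^esub> h_bil \<phi>' p"
    and "p' \<in> carrier P \<Longrightarrow> h_bil \<phi> (p \<oplus>\<^bsub>P\<^esub> p') = h_bil \<phi> p \<oplus>\<^bsub>Q\<^esub> h_bil \<phi> p'"
    and "b \<in> carrier B \<Longrightarrow> h_bil (\<phi> \<triangleleft>\<^bsub>Pd\<^esub> b) p = h_bil \<phi> (b \<triangleright>\<^bsub>P\<^esub> p)"
    and "c \<in> carrier k \<Longrightarrow> h_bil (c \<odot>\<^bsub>Pd\<^esub> \<phi>) p = c \<odot>\<^bsub>Q\<^esub> h_bil \<phi> p"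
    and "c \<in> carrier k \<Longrightarrow> h_bil \<phi> (c \<odot>\<^bsub>P\<^esub> p) = c \<odot>\<^bsub>Q\<^esub> h_bil \<phi> p"
    and "a \<in> carrier A \<Longrightarrow> h_bil (a \<triangleright>\<^bsub>Pd\<^esub> \<phi>) p = a \<triangleright>\<^bsub>Q\<^esub> h_bil \<phi> p"
    and "a \<in> carrier A \<Longrightarrow> h_bil \<phi> (p \<triangleleft>\<^bsub>P\<^esub> a) = h_bil \<phi> p \<triangleleft>\<^bsub>Q\<^esub> a"
proof -
  note Pd_closed = L.N.M.a_closed L.N.smult_closed L.N.lact_closed L.N.ract_closed
  have eq: "h_bil \<chi> q = h i (pure_at i (restr i \<chi>) q) \<and>
      restr i \<chi> \<in> carrier (D_at i) \<and> q \<in> carrier (P_at i)"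
    if "supports i \<chi> q" "\<chi> \<in> carrier Pd" "q \<in> carrier P" for i \<chi> q
    using that h_bil_eq [OF that] supports_P_at [of i \<chi> q] restr_closed [of i \<chi>]
    by (simp add: Pd_subset supports_def)
  note rops = restr_ops [folded Pd_ops]
  note apply_ops = dual_apply [folded Pd_ops]
  obtain i where s: "supports i \<phi> p" using \<phi> p by (rule ex_supports)
  then have i: "i \<in> I" by (simp add: supports_def)
  note e = eq [OF s \<phi> p]
  show "h_bil \<phi> p \<in> carrier Q"
    using e i by (simp add: h_pure_ops)
  {
    fix c assume c: "c \<in> carrier k"
    have "supports i (c \<odot>\<^bsub>Pd\<^esub> \<phi>) p" "supports i \<phi> (c \<odot>\<^bsub>P\<^esub> p)"
      using s c p by (simp_all add: supports_def apply_ops e_lact_closed P.lact_smult e_closed)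
    from this [THEN eq] show "h_bil (c \<odot>\<^bsub>Pd\<^esub> \<phi>) p = c \<odot>\<^bsub>Q\<^esub> h_bil \<phi> p"
      "h_bil \<phi> (c \<odot>\<^bsub>P\<^esub> p) = c \<odot>\<^bsub>Q\<^esub> h_bil \<phi> p"
      using c e i \<phi> p by (simp_all add: Pd_closed h_pure_ops rops Pd_subset)
  }
  {
    fix a assume a: "a \<in> carrier A"
    have "supports i (a \<triangleright>\<^bsub>Pd\<^esub> \<phi>) p" "supports i \<phi> (p \<triangleleft>\<^bsub>P\<^esub> a)"
      using s a p by (simp_all add: supports_def apply_ops e_lact_closed e_closed
          P.lact_ract [symmetric])
    from this [THEN eq] show "h_bil (a \<triangleright>\<^bsub>Pd\<^esub> \<phi>) p = a \<triangleright>\<^bsub>Q\<^esub> h_bil \<phi> p"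
      "h_bil \<phi> (p \<triangleleft>\<^bsub>P\<^esub> a) = h_bil \<phi> p \<triangleleft>\<^bsub>Q\<^esub> a"
      using a e i \<phi> p by (simp_all add: Pd_closed P.ract_closed h_pure_ops rops Pd_subset)
  }
  {
    assume \<phi>': "\<phi>' \<in> carrier Pd"
    obtain j where j: "j \<in> I" and s: "supports j \<phi> p" "supports j \<phi>' p"
      by (rule common_unit [of "{}" "{p}" "{\<phi>, \<phi>'}"])
        (use \<phi> \<phi>' p in \<open>auto simp: supports_def\<close>)
    then have "supports j (\<phi> \<oplus>\<^bsub>Pd\<^esub> \<phi>') p"
      using p by (simp add: supports_def apply_ops e_lact_closed)
    from eq [OF this] eq [OF s(1)] eq [OF s(2)]
    show "h_bil (\<phi> \<oplus>\<^bsub>Pd\<^esub> \<phi>') p = h_bil \<phi> p \<oplus>\<^bsub>Q\<^esub> h_bil \<phi>' p"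
      using j \<phi> \<phi>' p by (simp add: Pd_closed h_pure_ops rops Pd_subset)
  }
  {
    assume p': "p' \<in> carrier P"
    obtain j where j: "j \<in> I" and s: "supports j \<phi> p" "supports j \<phi> p'"
      by (rule common_unit [of "{}" "{p, p'}" "{\<phi>}"])
        (use \<phi> p' p in \<open>auto simp: supports_def\<close>)
    then have "supports j \<phi> (p \<oplus>\<^bsub>P\<^esub> p')"
      using p p' by (simp add: supports_def e_closed P.lact_add_r)
    from eq [OF this] eq [OF s(1)] eq [OF s(2)]
    show "h_bil \<phi> (p \<oplus>\<^bsub>P\<^esub> p') = h_bil \<phi> p \<oplus>\<^bsub>Q\<^esub> h_bil \<phi> p'"
      using j \<phi> p' p by (simp add: h_pure_ops)
  }
  {
    assume b: "b \<in> carrier B"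
    obtain j where j: "j \<in> I" and s: "supports j \<phi> p"
      and b': "e j \<otimes>\<^bsub>B\<^esub> b = b" "b \<otimes>\<^bsub>B\<^esub> e j = b"
      by (rule common_unit [of "{b}" "{p}" "{\<phi>}"])
        (use \<phi> b p in \<open>auto simp: supports_def\<close>)
    then have "b \<in> carrier (B_at j)"
      using b by (simp add: carrier_B_at)
    moreover have "supports j (\<phi> \<triangleleft>\<^bsub>Pd\<^esub> b) p" "supports j \<phi> (b \<triangleright>\<^bsub>P\<^esub> p)"
      using s j b b' p by (simp_all add: supports_def apply_ops e_lact_closed e_closed
          flip: P.lact_assoc)
    note eq [OF this(1)] eq [OF this(2)] eq [OF s]
    ultimately show "h_bil (\<phi> \<triangleleft>\<^bsub>Pd\<^esub> b) p = h_bil \<phi> (b \<triangleright>\<^bsub>P\<^esub> p)"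
      using j \<phi> b p by (simp add: Pd_closed P.lact_closed h_pure_ops rops Pd_subset)
  }
qed

text \<open>Uniqueness holds because the \<open>g\<^sub>i\<close> are jointly onto the pure tensors: \<open>\<phi> \<otimes> p\<close> is the image of
  \<open>restr i \<phi> \<otimes> p\<close> for any supporting \<open>i\<close>.\<close>

lemma factorization:
  "\<exists>!v. v \<in> bimod_hom k A A L Q \<and> (\<forall>i\<in>I. compose (carrier (G i)) v (g i) = h i)"
proof -
  obtain v where v: "v \<in> carrier L \<rightarrow>\<^sub>E carrier Q"
    and v_add: "\<And>x y. \<lbrakk>x \<in> carrier L; y \<in> carrier L\<rbrakk> \<Longrightarrow> v (x \<oplus>\<^bsub>L\<^esub> y) = v x \<oplus>\<^bsub>Q\<^esub> v y"
    and v_pure: "\<And>\<phi> p. \<lbrakk>\<phi> \<in> carrier Pd; p \<in> carrier P\<rbrakk> \<Longrightarrow> v (pure_L \<phi> p) = h_bil \<phi> p"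
    by (rule L.tensor_lift [OF Q.M.abelian_group_axioms, of h_bil])
      (use h_bil_ops in auto)
  note simps = v_add v_pure L.action_closed L.action_add L.action_pure L.N.lact_closed
    L.N.smult_closed P.ract_closed h_bil_ops PiE_mem [OF v]
  have v_hom: "v \<in> bimod_hom k A A L Q"
  proof (rule bimod_homI)
    fix c x assume c: "c \<in> carrier k" and x: "x \<in> carrier L"
    from x show "v (c \<odot>\<^bsub>L\<^esub> x) = c \<odot>\<^bsub>Q\<^esub> v x"
      by (induction x rule: L.tensor_induct) (simp_all add: simps c Q.smult_r_distr)
  next
    fix a x assume a: "a \<in> carrier A" and x: "x \<in> carrier L"
    from x show "v (a \<triangleright>\<^bsub>L\<^esub> x) = a \<triangleright>\<^bsub>Q\<^esub> v x"
      by (induction x rule: L.tensor_induct) (simp_all add: simps a Q.lact_add_r)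
  next
    fix a x assume a: "a \<in> carrier A" and x: "x \<in> carrier L"
    from x show "v (x \<triangleleft>\<^bsub>L\<^esub> a) = v x \<triangleleft>\<^bsub>Q\<^esub> a"
      by (induction x rule: L.tensor_induct) (simp_all add: simps a Q.ract_add_l)
  qed (simp_all add: v v_add)
  show ?thesis
  proof (rule ex1I [of _ v], intro conjI ballI v_hom)
    fix i assume i: "i \<in> I"
    show "compose (carrier (G i)) v (g i) = h i"
    proof (rule G_hom_eqI [OF i compose_bimod_hom [OF bimodule_G [OF i] g_hom [OF i] v_hom] h_hom [OF i]])
      fix \<psi> p assume \<psi>: "\<psi> \<in> carrier (D_at i)" and p: "p \<in> carrier (P_at i)"
      have "supports i (inflate i \<psi>) p"
        using i p by (simp add: supports_def carrier_P_at inflate_apply e_lact_closed e_lact_idem)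
      then show "compose (carrier (G i)) v (g i) (pure_at i \<psi> p) = h i (pure_at i \<psi> p)"
        using i \<psi> p
        by (simp add: compose_eq pure_at_closed g_pure incl_apply v_pure inflate_closed
            P_at_subset [OF i] h_bil_eq [of i] restr_inflate)
    qed
  next
    fix w assume w: "w \<in> bimod_hom k A A L Q \<and> (\<forall>i\<in>I. compose (carrier (G i)) w (g i) = h i)"
    show "w = v"
    proof (rule L.bimod_hom_eqI [OF conjunct1 [OF w] v_hom])
      fix \<phi> p assume \<phi>: "\<phi> \<in> carrier Pd" and p: "p \<in> carrier P"
      then obtain i where i: "supports i \<phi> p" by (rule ex_supports)
      then have "i \<in> I" by (simp add: supports_def)
      have "w (pure_L \<phi> p) = compose (carrier (G i)) w (g i) (pure_at i (restr i \<phi>) p)"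
        using \<open>i \<in> I\<close> i \<phi> p
        by (simp add: compose_eq pure_at_closed restr_closed Pd_subset supports_P_at g_pure_restr)
      also have "\<dots> = h i (pure_at i (restr i \<phi>) p)"
        using w \<open>i \<in> I\<close> by simp
      also have "\<dots> = v (pure_L \<phi> p)"
        using i \<phi> p by (simp add: v_pure h_bil_eq)
      finally show "w (pure_L \<phi> p) = v (pure_L \<phi> p)" .
    qed
  qed
qed

end

end

section \<open>The colimit of the comatrix bimodules\<close>

theorem proposition4p13:
  fixes k :: "'k ring" and A :: "('k, 'a) module" and B :: "('k, 'b) module"
    and P :: "('k, 'b, 'a, 'p) bimod"
    and I :: "'i set" and e :: "'i \<Rightarrow> 'b"
  assumes "cring k"
    and "unital_algebra k A"
    and "nonunital_algebra k B"
    and "idempotent_local_units B I e"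
    and "bimodule k B A P"
    and "left_firm k B P"
    and "right_unital A P"
    and "\<forall>i\<in>I. finitely_generated A (component P e i) \<and> projective k A (component P e i)"
  shows "is_colimit TYPE('q) k A I (idem_le B e) (G_obj k A B P e) (G_map k A B P e)
      (tensor k B (dagger A P I e) P) (g_map k A B P I e)
    \<and> (\<forall>i\<in>I. \<forall>\<phi>\<in>carrier (dual A (component P e i)). \<forall>p\<in>carrier (component P e i).
        g_map k A B P I e i
          (pure_tensor k (corner B e i) (dual A (component P e i)) (component P e i) \<phi> p) =
        pure_tensor k B (dagger A P I e) P (compose (carrier P) \<phi> (proj P e i)) (incl P e i p))"
proof -
  interpret firm_bimodule_local_units k A B P I e
    by (intro firm_bimodule_local_units.intro dual_of_bimodule.intro dual_of_bimodule_axioms.intro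
        firm_bimodule_local_units_axioms.intro assms(2,4-7))
  show ?thesis
    unfolding is_colimit_def
    by (intro conjI allI impI ballI direct_system_G cocone_L factorization g_pure)
qed

end
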